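(* Let $m\ge 3$ and let $\theta\in\mathbb{R}$ be the true ability parameter in a computerized adaptive test with response revision based on the nominal response model. For any item selection strategy and any revision strategy, as $n\to\infty$ we have $$\hat\theta_{\tau_n}\to\theta\quad\text{and}\quad\frac{I_{\tau_n}(\hat\theta_{\tau_n})}{I_{\tau_n}(\theta)}\to1\qquad\mathsf{P}_\theta\text{-almost surely}.$$
   Context: Nominal response model. Fix an integer $m\ge 3$ (number of categories). An item is characterized by real numbers $a_1,\dots,a_m,c_1,\dots,c_m$ with $\sum_{k=1}^m a_k=\sum_{k=1}^m c_k=0$, $\sum_{k=1}^m|a_k|\ne 0$ and $\sum_{k=1}^m|c_k|\neq 0$; it is identified with $\mathbf{b}=(a_2,\dots,a_m,c_2,\dots,c_m)\in\mathbb{R}^{2m-2}$ (so $a_1=-\sum_{k\ge2}a_k$, $c_1=-\sum_{k\ge2}c_k$). For $\theta\in\mathbb{R}$ set $p_k(\theta;\mathbf{b})=\exp(a_k\theta+c_k)/\sum_{h=1}^m\exp(a_h\theta+c_h)$. For a sequence $x_{1:j}=(x_1,\dots,x_j)$ of distinct categories, $0\le j\le m-2$ (empty if $j=0$), let $A=\{1,\dots,m\}\setminus\{x_1,\dots,x_j\}$ and define, for $k\in A$, $$p_k(\theta;\mathbf{b}\mid x_{1:j})=\frac{p_k(\theta;\mathbf{b})}{\sum_{h\in A}p_h(\theta;\mathbf{b})},\quad \bar a(\theta;\mathbf{b}\mid x_{1:j})=\sum_{h\in A}a_h\,p_h(\theta;\mathbf{b}\mid x_{1:j}),$$ $$s(\theta;\mathbf{b},k\mid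 x_{1:j})=a_k-\bar a(\theta;\mathbf{b}\mid x_{1:j}),\quad J(\theta;\mathbf{b}\mid x_{1:j})=\sum_{k\in A}\bigl(a_k-\bar a(\theta;\mathbf{b}\mid x_{1:j})\bigr)^2p_k(\theta;\mathbf{b}\mid x_{1:j}).$$ For $j=0$ write $s(\theta;\mathbf{b},k)$ and $J(\theta;\mathbf{b})$. All item vectors lie in a fixed nonempty compact set $\mathbb{B}\subset\mathbb{R}^{2m-2}$, each element $(a_2,\dots,a_m,c_2,\dots,c_m)$ of which, with $a_1=-\sum_{k\ge2}a_k$ and $c_1=-\sum_{k\ge2}c_k$, satisfies $\sum_{k=1}^m|a_k|\ne0$ and $\sum_{k=1}^m|c_k|\ne0$. CAT with revision. Responses (first answers and revisions) are indexed by $t=1,2,\dots$. After $t$ responses, $f_t$ is the number of distinct items administered ($f_1=1$) and $g_t^i$ is the number of responses so far on item $i\in\{1,\dots,f_t\}$. Each item may be revised at most $m-2$ times, so $1\le g_t^i\le m-1$; $C_t=\{i\le f_t: g_t^i<m-1\}$ is the set of items that can still be revised. The examinee's decision after the $t$-th response is a random variable $d_t\in\{0\}\cup C_t$: $d_t=0$ means that response $t+1$ is the first response to a new item (item $f_t+1$), and $d_t=i\in C_t$ means that it is a revision of item $i$; $d_t=0$ if $C_t=\emptyset$. The (otherwise arbitrary) sequence $(d_t)$ is the revision strategy. $X^i_j$ is the category chosen at the $j$-th attempt on item $i$, and $X^i_{1:j}=(X^i_1,\dots,X^i_j)$; previous answers to the same item cannot be repeated. Let $\mathcal{F}_t=\sigma\bigl(f_1,\dots,f_t,d_1,\dots,d_t,\;X^i_{1:g^i_t},\,1\le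 i\le f_t\bigr)$ and let $\mathcal F_0$ be trivial. For $n\ge1$ let $\tau_n=\min\{t\ge1: f_t=n\text{ and }d_t=0\}$, an $\{\mathcal{F}_t\}$-stopping time with $n\le\tau_n\le(m-1)n$. An item selection strategy is a sequence $(\mathbf{b}_i)$ of $\mathbb{B}$-valued random vectors with $\mathbf{b}_{i+1}$ being $\mathcal{F}_{\tau_i}$-measurable for $i\ge1$ and $\mathbf{b}_1$ deterministic; $\mathbf{b}_i$ characterizes item $i$. Model under $\mathsf{P}_\theta$: conditionally on $\mathcal{F}_{t}$, the $(t+1)$-th response has probability mass function $k\mapsto p_k(\theta;\mathbf{b}_{f_t+1})$ if it is the first response to a new item ($t=0$, with $f_0=0$, or $d_t=0$), and $k\mapsto p_k(\theta;\mathbf{b}_i\mid X^i_{1:g_t^i})$ on the remaining categories if $d_t=i\in C_t$. The law of the decisions is not otherwise specified. Score and information: for $\vartheta\in\mathbb{R}$, $$S_t(\vartheta)=\sum_{i=1}^{f_t}\Bigl[s(\vartheta;\mathbf{b}_i,X^i_1)+\sum_{j=2}^{g_t^i}s(\vartheta;\mathbf{b}_i,X^i_j\mid X^i_{1:j-1})\Bigr],$$ $$I_t(\vartheta)=\sum_{i=1}^{f_t}J(\vartheta;\mathbf{b}_i)+I_t^R(\vartheta),\quad I^R_t(\vartheta)=\sum_{i=1}^{f_t}\sum_{j=2}^{g^i_t}J(\vartheta;\mathbf{b}_i\mid X^i_{1:j-1}).$$ Estimator: $\hat\theta_t$ is $\mathcal{F}_t$-measurable and is the (unique) root of $S_t(\cdot)$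 whenever a root exists; when no root exists (which can only occur in an initial phase of the test) it is given by some arbitrary $\mathcal{F}_t$-measurable initialization rule. *)

theory Defs
  imports "HOL-Probability.Probability"
begin

section \<open>Nominal response model\<close>

text \<open>
  The \<open>m\<close> categories are the elements of \<^typ>\<open>'k option\<close> for a finite type \<open>'k\<close> with
  \<open>m - 1\<close> elements: \<^term>\<open>None\<close> is category 1 and the \<^term>\<open>Some k\<close> are categories
  \<open>2, \<dots>, m\<close>.  An item vector \<open>(a\<^sub>2, \<dots>, a\<^sub>m, c\<^sub>2, \<dots>, c\<^sub>m)\<close> is a pair of vectors indexed by \<open>'k\<close>,
  so that the type below is a copy of the Euclidean space of dimension \<open>2m - 2\<close>, with its topology.
\<close>

type_synonym 'k item = "(real ^ 'k) \<times> (real ^ 'k)"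

definition slope :: "'k::finite item \<Rightarrow> 'k option \<Rightarrow> real" where
  "slope \<beta> k = (case k of None \<Rightarrow> - (\<Sum>l\<in>UNIV. fst \<beta> $ l) | Some l \<Rightarrow> fst \<beta> $ l)"

definition intercept :: "'k::finite item \<Rightarrow> 'k option \<Rightarrow> real" where
  "intercept \<beta> k = (case k of None \<Rightarrow> - (\<Sum>l\<in>UNIV. snd \<beta> $ l) | Some l \<Rightarrow> snd \<beta> $ l)"

definition nondegenerate_item :: "'k::finite item \<Rightarrow> bool" where
  "nondegenerate_item \<beta> \<longleftrightarrow>
     (\<Sum>k\<in>UNIV. \<bar>slope \<beta> k\<bar>) \<noteq> 0 \<and> (\<Sum>k\<in>UNIV. \<bar>intercept \<beta> k\<bar>) \<noteq> 0"

definition cat_prob :: "real \<Rightarrow> 'k::finite item \<Rightarrow> 'k option \<Rightarrow> real" where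
  "cat_prob \<theta> \<beta> k =
     exp (slope \<beta> k * \<theta> + intercept \<beta> k) / (\<Sum>h\<in>UNIV. exp (slope \<beta> h * \<theta> + intercept \<beta> h))"

text \<open>
  In the following, \<open>xs\<close> is the list of the previous answers to the item, and \<open>- set xs\<close> is the
  set \<open>A\<close> of remaining categories.  For \<open>xs = []\<close> one gets the unconditional quantities.
\<close>

definition cond_prob_cat :: "real \<Rightarrow> 'k::finite item \<Rightarrow> 'k option list \<Rightarrow> 'k option \<Rightarrow> real" where
  "cond_prob_cat \<theta> \<beta> xs k = cat_prob \<theta> \<beta> k / (\<Sum>h\<in>- set xs. cat_prob \<theta> \<beta> h)"

definition mean_slope :: "real \<Rightarrow> 'k::finite item \<Rightarrow> 'k option list \<Rightarrow> real" where
  "mean_slope \<theta> \<beta> xs = (\<Sum>h\<in>- set xs. slope \<beta> h * cond_prob_cat \<theta> \<beta> xs h)"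

definition item_score :: "real \<Rightarrow> 'k::finite item \<Rightarrow> 'k option \<Rightarrow> 'k option list \<Rightarrow> real" where
  "item_score \<theta> \<beta> k xs = slope \<beta> k - mean_slope \<theta> \<beta> xs"

definition item_info :: "real \<Rightarrow> 'k::finite item \<Rightarrow> 'k option list \<Rightarrow> real" where
  "item_info \<theta> \<beta> xs =
     (\<Sum>k\<in>- set xs. (slope \<beta> k - mean_slope \<theta> \<beta> xs)\<^sup>2 * cond_prob_cat \<theta> \<beta> xs k)"


section \<open>Adaptive testing with response revision\<close>

text \<open>
  \<open>d t \<omega>\<close> is the decision after the \<open>t\<close>-th response, for \<open>t \<ge> 1\<close>; the value \<open>d 0\<close> is never used,
  since the first response is always to a new item.  Items and attempts are numbered from 1.
\<close>

definition next_is_new :: "(nat \<Rightarrow> 'w \<Rightarrow> nat) \<Rightarrow> nat \<Rightarrow> 'w \<Rightarrow> bool" where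
  "next_is_new d t \<omega> \<longleftrightarrow> t = 0 \<or> d t \<omega> = 0"

primrec items_seen :: "(nat \<Rightarrow> 'w \<Rightarrow> nat) \<Rightarrow> nat \<Rightarrow> 'w \<Rightarrow> nat" where
  "items_seen d 0 \<omega> = 0"
| "items_seen d (Suc t) \<omega> = (if next_is_new d t \<omega> then items_seen d t \<omega> + 1 else items_seen d t \<omega>)"

text \<open>
  \<open>next_item d t\<close> is the item to which response \<open>t + 1\<close> is given, so the first \<open>t\<close> responses
  belong to the items \<open>next_item d s\<close> with \<open>s < t\<close>.
\<close>

definition next_item :: "(nat \<Rightarrow> 'w \<Rightarrow> nat) \<Rightarrow> nat \<Rightarrow> 'w \<Rightarrow> nat" where
  "next_item d t \<omega> = (if next_is_new d t \<omega> then items_seen d t \<omega> + 1 else d t \<omega>)"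

definition attempts :: "(nat \<Rightarrow> 'w \<Rightarrow> nat) \<Rightarrow> nat \<Rightarrow> nat \<Rightarrow> 'w \<Rightarrow> nat" where
  "attempts d t i \<omega> = card {s. s < t \<and> next_item d s \<omega> = i}"

definition revisable :: "nat \<Rightarrow> (nat \<Rightarrow> 'w \<Rightarrow> nat) \<Rightarrow> nat \<Rightarrow> 'w \<Rightarrow> nat set" where
  "revisable m d t \<omega> = {i. 1 \<le> i \<and> i \<le> items_seen d t \<omega> \<and> attempts d t i \<omega> < m - 1}"

definition revision_strategy :: "nat \<Rightarrow> 'w measure \<Rightarrow> (nat \<Rightarrow> 'w \<Rightarrow> nat) \<Rightarrow> bool" where
  "revision_strategy m M d \<longleftrightarrow>
     (\<forall>t\<ge>1. d t \<in> measurable M (count_space UNIV) \<and>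
            (\<forall>\<omega>\<in>space M. d t \<omega> \<in> {0} \<union> revisable m d t \<omega>))"

text \<open>
  \<open>X i j \<omega>\<close> is the category chosen at the \<open>j\<close>-th attempt on item \<open>i\<close>.  Its value is irrelevant
  for attempts that do not take place.  \<open>answers X i j \<omega>\<close> is the sequence of the first \<open>j\<close> answers.
\<close>

definition answers :: "(nat \<Rightarrow> nat \<Rightarrow> 'w \<Rightarrow> 'c) \<Rightarrow> nat \<Rightarrow> nat \<Rightarrow> 'w \<Rightarrow> 'c list" where
  "answers X i j \<omega> = map (\<lambda>l. X i l \<omega>) [1..<Suc j]"

definition next_response ::
  "(nat \<Rightarrow> 'w \<Rightarrow> nat) \<Rightarrow> (nat \<Rightarrow> nat \<Rightarrow> 'w \<Rightarrow> 'c) \<Rightarrow> nat \<Rightarrow> 'w \<Rightarrow> 'c" where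
  "next_response d X t \<omega> = (let i = next_item d t \<omega> in X i (attempts d t i \<omega> + 1) \<omega>)"

text \<open>
  The \<open>\<sigma>\<close>-algebra generated by the items seen, the decisions and the random-length answer sequences
  up to time \<open>t\<close>: all of these are discrete, so it is generated by the tuple of all of them,
  a random element of a countable set.  It is trivial for \<open>t = 0\<close>.
\<close>

definition history ::
  "(nat \<Rightarrow> 'w \<Rightarrow> nat) \<Rightarrow> (nat \<Rightarrow> nat \<Rightarrow> 'w \<Rightarrow> 'c) \<Rightarrow> nat \<Rightarrow> 'w \<Rightarrow> nat list \<times> nat list \<times> 'c list list"
  where
  "history d X t \<omega> =
     (map (\<lambda>s. items_seen d s \<omega>) [1..<Suc t],
      map (\<lambda>s. d s \<omega>) [1..<Suc t],
      map (\<lambda>i. answers X i (attempts d t i \<omega>) \<omega>) [1..<Suc (items_seen d t \<omega>)])"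

definition hist_algebra ::
  "'w measure \<Rightarrow> (nat \<Rightarrow> 'w \<Rightarrow> nat) \<Rightarrow> (nat \<Rightarrow> nat \<Rightarrow> 'w \<Rightarrow> 'c) \<Rightarrow> nat \<Rightarrow> 'w measure" where
  "hist_algebra M d X t = vimage_algebra (space M) (history d X t) (count_space UNIV)"

text \<open>
  Under a revision strategy the set below is nonempty for every \<open>n \<ge> 1\<close>: once all items seen have
  been answered \<open>m - 1\<close> times, the only possible decision is 0.
\<close>

definition completion_time :: "(nat \<Rightarrow> 'w \<Rightarrow> nat) \<Rightarrow> nat \<Rightarrow> 'w \<Rightarrow> nat" where
  "completion_time d n \<omega> = (LEAST t. t \<ge> 1 \<and> items_seen d t \<omega> = n \<and> d t \<omega> = 0)"

definition item_selection_strategy ::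
  "'w measure \<Rightarrow> (nat \<Rightarrow> 'w \<Rightarrow> nat) \<Rightarrow> (nat \<Rightarrow> nat \<Rightarrow> 'w \<Rightarrow> 'k::finite option) \<Rightarrow> 'k item set \<Rightarrow>
   (nat \<Rightarrow> 'w \<Rightarrow> 'k item) \<Rightarrow> bool" where
  "item_selection_strategy M d X B b \<longleftrightarrow>
     (\<forall>i\<ge>1. \<forall>\<omega>\<in>space M. b i \<omega> \<in> B) \<and>
     (\<exists>\<beta>. \<forall>\<omega>\<in>space M. b 1 \<omega> = \<beta>) \<and>
     (\<forall>i\<ge>1. b (i + 1) \<in> borel_measurable
        (filtration.pre_sigma (space M) (hist_algebra M d X) (completion_time d i)))"

text \<open>
  \<open>M\<close> plays the role of the law under ability \<open>\<theta>\<close>.  In the last clause the conditional probabilities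
  of the remaining categories add up to 1, so nothing has to be said about the others.
\<close>

definition nominal_responses ::
  "'w measure \<Rightarrow> real \<Rightarrow> (nat \<Rightarrow> 'w \<Rightarrow> nat) \<Rightarrow> (nat \<Rightarrow> nat \<Rightarrow> 'w \<Rightarrow> 'k::finite option) \<Rightarrow>
   (nat \<Rightarrow> 'w \<Rightarrow> 'k item) \<Rightarrow> bool" where
  "nominal_responses M \<theta> d X b \<longleftrightarrow>
     (\<forall>i\<ge>1. \<forall>j\<ge>1. X i j \<in> measurable M (count_space UNIV)) \<and>
     (\<forall>\<omega>\<in>space M. \<forall>t\<ge>1. \<forall>i\<in>{1..items_seen d t \<omega>}. distinct (answers X i (attempts d t i \<omega>) \<omega>)) \<and>
     (\<forall>t k. AE \<omega> in M. next_is_new d t \<omega> \<longrightarrow>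
        real_cond_exp M (hist_algebra M d X t)
          (indicat_real {\<omega>'\<in>space M. next_response d X t \<omega>' = k}) \<omega>
        = cat_prob \<theta> (b (items_seen d t \<omega> + 1) \<omega>) k) \<and>
     (\<forall>t\<ge>1. \<forall>i\<ge>1. \<forall>k. AE \<omega> in M.
        d t \<omega> = i \<and> k \<notin> set (answers X i (attempts d t i \<omega>) \<omega>) \<longrightarrow>
        real_cond_exp M (hist_algebra M d X t)
          (indicat_real {\<omega>'\<in>space M. next_response d X t \<omega>' = k}) \<omega>
        = cond_prob_cat \<theta> (b i \<omega>) (answers X i (attempts d t i \<omega>) \<omega>) k)"

definition total_score ::
  "(nat \<Rightarrow> 'w \<Rightarrow> nat) \<Rightarrow> (nat \<Rightarrow> nat \<Rightarrow> 'w \<Rightarrow> 'k::finite option) \<Rightarrow> (nat \<Rightarrow> 'w \<Rightarrow> 'k item) \<Rightarrow>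
   nat \<Rightarrow> real \<Rightarrow> 'w \<Rightarrow> real" where
  "total_score d X b t x \<omega> =
     (\<Sum>i = 1..items_seen d t \<omega>.
        item_score x (b i \<omega>) (X i 1 \<omega>) [] +
        (\<Sum>j = 2..attempts d t i \<omega>. item_score x (b i \<omega>) (X i j \<omega>) (answers X i (j - 1) \<omega>)))"

definition revision_info ::
  "(nat \<Rightarrow> 'w \<Rightarrow> nat) \<Rightarrow> (nat \<Rightarrow> nat \<Rightarrow> 'w \<Rightarrow> 'k::finite option) \<Rightarrow> (nat \<Rightarrow> 'w \<Rightarrow> 'k item) \<Rightarrow>
   nat \<Rightarrow> real \<Rightarrow> 'w \<Rightarrow> real" where
  "revision_info d X b t x \<omega> =
     (\<Sum>i = 1..items_seen d t \<omega>.
        \<Sum>j = 2..attempts d t i \<omega>. item_info x (b i \<omega>) (answers X i (j - 1) \<omega>))"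

definition total_info ::
  "(nat \<Rightarrow> 'w \<Rightarrow> nat) \<Rightarrow> (nat \<Rightarrow> nat \<Rightarrow> 'w \<Rightarrow> 'k::finite option) \<Rightarrow> (nat \<Rightarrow> 'w \<Rightarrow> 'k item) \<Rightarrow>
   nat \<Rightarrow> real \<Rightarrow> 'w \<Rightarrow> real" where
  "total_info d X b t x \<omega> =
     (\<Sum>i = 1..items_seen d t \<omega>. item_info x (b i \<omega>) []) + revision_info d X b t x \<omega>"

text \<open>
  Where the score has no root, the estimator is any measurable function of the history.
\<close>

definition score_root_estimator ::
  "'w measure \<Rightarrow> (nat \<Rightarrow> 'w \<Rightarrow> nat) \<Rightarrow> (nat \<Rightarrow> nat \<Rightarrow> 'w \<Rightarrow> 'k::finite option) \<Rightarrow>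
   (nat \<Rightarrow> 'w \<Rightarrow> 'k item) \<Rightarrow> (nat \<Rightarrow> 'w \<Rightarrow> real) \<Rightarrow> bool" where
  "score_root_estimator M d X b est \<longleftrightarrow>
     (\<forall>t\<ge>1. est t \<in> borel_measurable (hist_algebra M d X t) \<and>
        (\<forall>\<omega>\<in>space M. (\<exists>x. total_score d X b t x \<omega> = 0) \<longrightarrow>
           total_score d X b t (est t \<omega>) \<omega> = 0))"

end

theory Submission
  imports Defs "HOL-Library.Discrete_Functions"
begin

text \<open>
  Each response contributes to the score at the true ability a bounded term whose conditional
  expectation given the past is zero, since the conditional response probabilities average the
  slopes to their mean.  These terms are therefore orthogonal, and the score at \<open>\<theta>\<close> after \<open>t\<close>
  responses, divided by \<open>t\<close>, tends to zero almost surely.  The score is nonincreasing in the ability,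
  and by compactness of the item pool the first answers make it drop between \<open>\<theta> - \<epsilon>\<close>, \<open>\<theta>\<close> and
  \<open>\<theta> + \<epsilon>\<close> by amounts linear in the number of items.  As there are at most \<open>m - 1\<close> responses per
  item, the drop eventually dominates the score at \<open>\<theta>\<close>, so that there is a root and every root lies within
  \<open>\<epsilon>\<close> of \<open>\<theta>\<close>.  The information is bounded below by a multiple of the number of items, and each of its
  summands is equicontinuous at \<open>\<theta>\<close>, which gives the second limit.

  Histories are discrete, so measurability with respect to the history amounts to being
  a function of the history on the sample space.
\<close>

section \<open>The nominal response model on a compact set of items\<close>

definition weight :: "real \<Rightarrow> 'k::finite item \<Rightarrow> 'k option \<Rightarrow> real" where
  "weight x \<beta> k = exp (slope \<beta> k * x + intercept \<beta> k)"

lemma weight_pos: "0 < weight x \<beta> k"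
  by (simp add: weight_def)

text \<open>A change of ability tilts the weights by a factor exponential in the slope, so two
  abilities can be compared over the same base weights.\<close>

lemma weight_shift: "weight y \<beta> k = exp (slope \<beta> k * (y - x)) * weight x \<beta> k"
  by (simp add: weight_def flip: exp_add) (simp add: algebra_simps)

lemma sum_weight_pos: "A \<noteq> {} \<Longrightarrow> 0 < (\<Sum>h\<in>A. weight x \<beta> h)"
  by (intro sum_pos weight_pos) auto

text \<open>The normalising sum over all categories cancels. If no category remains, both sides are
  0 by the convention for division by zero.\<close>

lemma cond_prob_cat_weight:
  "cond_prob_cat x \<beta> xs k = weight x \<beta> k / (\<Sum>h\<in>- set xs. weight x \<beta> h)"
proof -
  have "(\<Sum>h\<in>UNIV. weight x \<beta> h) > 0" by (rule sum_weight_pos) simp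
  then show ?thesis
    by (simp add: cond_prob_cat_def cat_prob_def flip: weight_def sum_divide_distrib)
qed

lemma cond_prob_cat_Nil: "cond_prob_cat x \<beta> [] k = cat_prob x \<beta> k"
  by (simp add: cond_prob_cat_weight cat_prob_def weight_def)

lemma cond_prob_cat_nonneg: "0 \<le> cond_prob_cat x \<beta> xs k"
  by (simp add: cond_prob_cat_weight sum_nonneg less_imp_le weight_pos)

lemma sum_cond_prob_cat:
  assumes "- set xs \<noteq> {}"
  shows "(\<Sum>k\<in>- set xs. cond_prob_cat x \<beta> xs k) = 1"
  using sum_weight_pos[OF assms, of x \<beta>]
  by (simp add: cond_prob_cat_weight flip: sum_divide_distrib)

lemma mean_slope_weight:
  "mean_slope x \<beta> xs =
     (\<Sum>h\<in>- set xs. slope \<beta> h * weight x \<beta> h) / (\<Sum>h\<in>- set xs. weight x \<beta> h)"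
  by (simp add: mean_slope_def cond_prob_cat_weight sum_divide_distrib)

text \<open>The score is the slope centred at its conditional mean. At the true ability this
  identity makes the score contributions orthogonal to the past.\<close>

lemma mean_item_score:
  "(\<Sum>k\<in>- set xs. item_score x \<beta> k xs * cond_prob_cat x \<beta> xs k) = 0"
proof (cases "- set xs = {}")
  case False
  have "(\<Sum>k\<in>- set xs. item_score x \<beta> k xs * cond_prob_cat x \<beta> xs k) =
    mean_slope x \<beta> xs - mean_slope x \<beta> xs * (\<Sum>k\<in>- set xs. cond_prob_cat x \<beta> xs k)"
    by (simp add: item_score_def left_diff_distrib sum_subtractf sum_distrib_left)
       (simp add: mean_slope_def)
  then show ?thesis
    using sum_cond_prob_cat[OF False] by simp
qed (simp only: sum.empty)

lemma slope_sum: "(\<Sum>k\<in>UNIV. slope \<beta> k) = 0"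
  by (simp add: UNIV_option_conv sum.reindex slope_def)

text \<open>Slopes sum to zero, so constant slopes would all vanish, which nondegeneracy
  excludes.\<close>

lemma nondegenerate_slope:
  assumes "nondegenerate_item \<beta>"
  obtains k where "slope \<beta> k \<noteq> c"
proof (rule ccontr)
  assume "\<not> thesis"
  then have all: "slope \<beta> k = c" for k
    using that by blast
  have "c = 0"
    using slope_sum[of \<beta>] by (simp add: all card_eq_0_iff)
  with all assms show False
    by (simp add: nondegenerate_item_def)
qed

text \<open>With \<open>e\<^sub>h = exp (a\<^sub>h (y - x))\<close> the left-hand side compares the mean slopes at the abilities \<open>x\<close> and
  \<open>y\<close>; the symmetrisation makes every summand nonnegative, because \<open>a\<close> and \<open>e\<close> are similarly ordered.\<close>

lemma chebyshev_symmetrised: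
  fixes a e w :: "'i \<Rightarrow> real"
  shows "2 * ((\<Sum>h\<in>A. a h * (e h * w h)) * (\<Sum>k\<in>A. w k) - (\<Sum>h\<in>A. a h * w h) * (\<Sum>k\<in>A. e k * w k))
    = (\<Sum>h\<in>A. \<Sum>k\<in>A. (a h - a k) * (e h - e k) * (w h * w k))"
proof -
  \<comment> \<open>\<open>Q\<close> is one half of the symmetrised summand; the other half arises
    by exchanging the indices.\<close>
  define Q where "Q h k = a h * (e h - e k) * (w h * w k)" for h k
  have "(\<Sum>h\<in>A. a h * (e h * w h)) * (\<Sum>k\<in>A. w k) - (\<Sum>h\<in>A. a h * w h) * (\<Sum>k\<in>A. e k * w k)
      = (\<Sum>h\<in>A. \<Sum>k\<in>A. Q h k)"
    unfolding sum_product sum_subtractf[symmetric] Q_def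
    by (intro sum.cong refl) (simp add: algebra_simps)
  moreover have "(\<Sum>h\<in>A. \<Sum>k\<in>A. Q h k) = (\<Sum>h\<in>A. \<Sum>k\<in>A. Q k h)"
    by (rule sum.swap)
  moreover have "(\<Sum>h\<in>A. \<Sum>k\<in>A. Q h k) + (\<Sum>h\<in>A. \<Sum>k\<in>A. Q k h)
      = (\<Sum>h\<in>A. \<Sum>k\<in>A. (a h - a k) * (e h - e k) * (w h * w k))"
    unfolding sum.distrib[symmetric] Q_def by (intro sum.cong refl) (simp add: algebra_simps)
  ultimately show ?thesis by simp
qed

section \<open>Monotonicity of the mean slope in the ability, and positivity of the
  information\<close>

lemma exp_slope_mono:
  assumes "0 \<le> (z::real)"
  shows "0 \<le> (a - c) * (exp (a * z) - exp (c * z))"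
  using assms by (cases a c rule: linorder_cases)
    (auto simp: mult_nonpos_nonpos mult_nonneg_nonneg mult_right_mono)

lemma exp_slope_strict_mono:
  assumes "0 < (z::real)" and "a \<noteq> c"
  shows "0 < (a - c) * (exp (a * z) - exp (c * z))"
  using assms by (cases a c rule: linorder_cases) (auto simp: mult_neg_neg)

text \<open>Clearing the positive denominators leaves the nonnegativity of the symmetrised double
  sum.\<close>

lemma mean_slope_mono:
  assumes "x \<le> y"
  shows "mean_slope x \<beta> xs \<le> mean_slope y \<beta> xs"
proof (cases "- set xs = {}")
  case True
  then show ?thesis by (simp add: mean_slope_def)
next
  case False
  have "0 \<le> (\<Sum>h\<in>- set xs. \<Sum>k\<in>- set xs. (slope \<beta> h - slope \<beta> k) *
      (exp (slope \<beta> h * (y - x)) - exp (slope \<beta> k * (y - x))) * (weight x \<beta> h * weight x \<beta> k))"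
    using assms by (intro sum_nonneg mult_nonneg_nonneg[OF exp_slope_mono])
      (auto intro: less_imp_le mult_pos_pos weight_pos)
  then show ?thesis
    unfolding chebyshev_symmetrised[symmetric] weight_shift[of y _ _ x, symmetric] mean_slope_weight
    using sum_weight_pos[OF False] by (simp add: divide_simps)
qed

lemma mean_slope_strict_mono:
  assumes "x < y" and "nondegenerate_item \<beta>"
  shows "mean_slope x \<beta> [] < mean_slope y \<beta> []"
proof -
  \<comment> \<open>Slopes are not constant, so some slope differs from that of \<open>None\<close>;
    the pair \<open>(k, None)\<close> alone gives a strictly positive summand.\<close>
  obtain k where k: "slope \<beta> k \<noteq> slope \<beta> None"
    using nondegenerate_slope[OF assms(2)] by blast
  define Q where "Q h k = (slope \<beta> h - slope \<beta> k) *
      (exp (slope \<beta> h * (y - x)) - exp (slope \<beta> k * (y - x))) * (weight x \<beta> h * weight x \<beta> k)" for h k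
  have Q: "0 \<le> Q h k" for h k
    unfolding Q_def using assms(1) by (intro mult_nonneg_nonneg[OF exp_slope_mono])
      (auto intro: less_imp_le mult_pos_pos weight_pos)
  have "0 < Q k None"
    unfolding Q_def using assms(1) k by (intro mult_pos_pos[OF exp_slope_strict_mono])
      (auto intro: mult_pos_pos weight_pos)
  then have "0 < (\<Sum>h\<in>- set []. \<Sum>k\<in>- set []. Q h k)"
    using Q by (intro sum_pos2[of _ k] sum_pos2[of _ None] sum_nonneg) auto
  then show ?thesis
    unfolding chebyshev_symmetrised[symmetric] weight_shift[of y _ _ x, symmetric] mean_slope_weight Q_def
    using sum_weight_pos[of UNIV x \<beta>] sum_weight_pos[of UNIV y \<beta>] by (simp add: divide_simps)
qed

lemma item_score_antimono: "x \<le> y \<Longrightarrow> item_score y \<beta> k xs \<le> item_score x \<beta> k xs"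
  by (simp add: item_score_def mean_slope_mono)

lemma item_info_nonneg: "0 \<le> item_info x \<beta> xs"
  by (simp add: item_info_def sum_nonneg cond_prob_cat_nonneg)

text \<open>The information is the variance of the slope under strictly positive probabilities, so
  it vanishes only for constant slopes.\<close>

lemma item_info_pos:
  assumes "nondegenerate_item \<beta>"
  shows "0 < item_info x \<beta> []"
proof -
  obtain k where k: "slope \<beta> k \<noteq> mean_slope x \<beta> []"
    using nondegenerate_slope[OF assms] by blast
  have "0 < cond_prob_cat x \<beta> [] k"
    using sum_weight_pos[of UNIV x \<beta>] by (simp add: cond_prob_cat_weight weight_pos)
  with k show ?thesis
    unfolding item_info_def by (intro sum_pos2[of _ k]) (auto simp: cond_prob_cat_nonneg)
qed

text \<open>Only the set of previous answers matters. This leaves finitely many cases and allows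
  uniformity over all answer lists.\<close>

lemma item_info_cong:
  "set xs = set ys \<Longrightarrow> item_info x \<beta> xs = item_info x \<beta> ys"
  by (simp add: item_info_def mean_slope_def cond_prob_cat_def)

lemma abs_mean_slope_le:
  assumes "\<And>k. \<bar>slope \<beta> k\<bar> \<le> K"
  shows "\<bar>mean_slope x \<beta> xs\<bar> \<le> K"
proof (cases "- set xs = {}")
  case True
  then show ?thesis
    \<comment> \<open>Here the mean slope is an empty sum, and any one category shows that
      \<open>K\<close> is nonnegative.\<close>
    using assms[of undefined] by (simp add: mean_slope_def)
next
  case False
  have "\<bar>mean_slope x \<beta> xs\<bar> \<le> (\<Sum>h\<in>- set xs. K * cond_prob_cat x \<beta> xs h)"
    unfolding mean_slope_def
    by (rule order_trans[OF sum_abs])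
       (intro sum_mono, simp add: abs_mult cond_prob_cat_nonneg mult_right_mono assms)
  then show ?thesis
    by (simp add: sum_cond_prob_cat[OF False] flip: sum_distrib_left)
qed

section \<open>Continuity in ability and item, and uniform bounds over a compact pool\<close>

lemma continuous_on_slope [continuous_intros]:
  "continuous_on S f \<Longrightarrow> continuous_on S (\<lambda>z. slope (f z) k)"
  by (cases k) (auto simp: slope_def intro!: continuous_intros)

lemma continuous_on_intercept [continuous_intros]:
  "continuous_on S f \<Longrightarrow> continuous_on S (\<lambda>z. intercept (f z) k)"
  by (cases k) (auto simp: intercept_def intro!: continuous_intros)

lemma continuous_on_weight [continuous_intros]:
  "continuous_on S g \<Longrightarrow> continuous_on S f \<Longrightarrow> continuous_on S (\<lambda>z. weight (g z) (f z) k)"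
  unfolding weight_def by (intro continuous_intros)

lemma continuous_on_cond_prob_cat [continuous_intros]:
  assumes "continuous_on S g" "continuous_on S f"
  shows "continuous_on S (\<lambda>z. cond_prob_cat (g z) (f z) xs k)"
proof (cases "- set xs = {}")
  case True
  then show ?thesis by (simp add: cond_prob_cat_def)
next
  case False
  then show ?thesis
    unfolding cond_prob_cat_weight using sum_weight_pos[OF False]
    by (intro continuous_intros assms) (metis less_irrefl)
qed

lemma continuous_on_mean_slope [continuous_intros]:
  "continuous_on S g \<Longrightarrow> continuous_on S f \<Longrightarrow> continuous_on S (\<lambda>z. mean_slope (g z) (f z) xs)"
  unfolding mean_slope_def by (intro continuous_intros)

lemma continuous_on_item_info [continuous_intros]:
  "continuous_on S g \<Longrightarrow> continuous_on S f \<Longrightarrow> continuous_on S (\<lambda>z. item_info (g z) (f z) xs)"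
  unfolding item_info_def by (intro continuous_intros)

text \<open>The minimum is attained and positive. The resulting constant serves every adaptive
  choice of items at once.\<close>

lemma compact_uniform_pos:
  fixes f :: "'a::topological_space \<Rightarrow> real"
  assumes "compact B" and "continuous_on B f" and "\<And>\<beta>. \<beta> \<in> B \<Longrightarrow> 0 < f \<beta>"
  shows "\<exists>c>0. \<forall>\<beta>\<in>B. c \<le> f \<beta>"
proof (cases "B = {}")
  case True
  then show ?thesis by (intro exI[of _ 1]) simp
next
  case False
  then show ?thesis
    using continuous_attains_inf[OF assms(1) False assms(2)] assms(3) by metis
qed

text \<open>A mean slope is an average of slopes, so bounding the finitely many slopes over the pool
  suffices, uniformly in the ability and the answers.\<close>

lemma item_score_bounded:
  assumes "compact B"
  obtains K where "\<And>x \<beta> k xs. \<beta> \<in> B \<Longrightarrow> \<bar>item_score x \<beta> k xs\<bar> \<le> K"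
proof -
  have "\<exists>K. \<forall>\<beta>\<in>B. \<bar>slope \<beta> k\<bar> \<le> K" for k
  proof -
    have "compact ((\<lambda>\<beta>. slope \<beta> k) ` B)"
      using assms by (intro compact_continuous_image continuous_intros)
    then show ?thesis
      using compact_imp_bounded bounded_iff[of "(\<lambda>\<beta>. slope \<beta> k) ` B"] by fastforce
  qed
  then obtain K where K: "\<And>k \<beta>. \<beta> \<in> B \<Longrightarrow> \<bar>slope \<beta> k\<bar> \<le> K k"
    by metis
  define L where "L = (\<Sum>k\<in>UNIV. \<bar>K k\<bar>)"
  have L: "\<bar>slope \<beta> k\<bar> \<le> L" if "\<beta> \<in> B" for \<beta> k
  proof -
    have "\<bar>K k\<bar> \<le> L" unfolding L_def by (rule member_le_sum) auto
    with K[OF that, of k] show ?thesis by linarith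
  qed
  show ?thesis
  proof (rule that[of "2 * L"])
    show "\<bar>item_score x \<beta> k xs\<bar> \<le> 2 * L" if "\<beta> \<in> B" for x \<beta> k xs
      using L[OF that, of k] abs_mean_slope_le[OF L[OF that], of x xs]
      by (simp add: item_score_def)
  qed
qed

text \<open>For a fixed answer list this is uniform continuity on a compact product; the lists
  reduce to finitely many answer sets.\<close>

lemma item_info_equicontinuous:
  fixes B :: "'k::finite item set"
  assumes "compact B" and "0 < e"
  shows "\<forall>\<^sub>F x in nhds \<theta>. \<forall>\<beta>\<in>B. \<forall>xs. \<bar>item_info x \<beta> xs - item_info \<theta> \<beta> xs\<bar> < e"
proof -
  have single: "\<forall>\<^sub>F x in nhds \<theta>. \<forall>\<beta>\<in>B. \<bar>item_info x \<beta> xs - item_info \<theta> \<beta> xs\<bar> < e" for xs :: "'k option list"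
  proof -
    have "uniformly_continuous_on (cball \<theta> 1 \<times> B) (\<lambda>z. item_info (fst z) (snd z) xs)"
      using assms(1) by (intro compact_uniformly_continuous compact_Times continuous_intros) auto
    then obtain \<delta> where "0 < \<delta>" and \<delta>: "\<And>z z'. z \<in> cball \<theta> 1 \<times> B \<Longrightarrow> z' \<in> cball \<theta> 1 \<times> B \<Longrightarrow>
        dist z' z < \<delta> \<Longrightarrow> dist (item_info (fst z') (snd z') xs) (item_info (fst z) (snd z) xs) < e"
      using assms(2) unfolding uniformly_continuous_on_def by metis
    have "\<bar>item_info x \<beta> xs - item_info \<theta> \<beta> xs\<bar> < e" if "dist x \<theta> < min \<delta> 1" "\<beta> \<in> B" for x \<beta>
      using that \<delta>[of "(\<theta>, \<beta>)" "(x, \<beta>)"] by (simp add: dist_Pair_Pair dist_commute dist_real_def)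
    with \<open>0 < \<delta>\<close> show ?thesis
      unfolding eventually_nhds_metric by (intro exI[of _ "min \<delta> 1"]) auto
  qed
  \<comment> \<open>One representative list is chosen for each set \<open>C\<close> of categories,
    so only a finite intersection of neighbourhoods is taken.\<close>
  have "\<forall>\<^sub>F x in nhds \<theta>. \<forall>C\<in>(UNIV :: 'k option set set). \<forall>\<beta>\<in>B.
      \<bar>item_info x \<beta> (SOME xs. set xs = C) - item_info \<theta> \<beta> (SOME xs. set xs = C)\<bar> < e"
    by (rule eventually_ball_finite) (auto intro: single)
  then show ?thesis
  proof eventually_elim
    case (elim x)
    show ?case
    proof (intro ballI allI)
      fix \<beta> :: "'k item" and xs :: "'k option list"
      assume "\<beta> \<in> B"
      moreover have "set (SOME ys. set ys = set xs) = set xs"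
        by (rule someI[of _ xs]) simp
      note item_info_cong[OF this]
      ultimately show "\<bar>item_info x \<beta> xs - item_info \<theta> \<beta> xs\<bar> < e"
        using elim[rule_format, of "set xs" \<beta>] by simp
    qed
  qed
qed


section \<open>A law of large numbers for bounded orthogonal variables\<close>

context prob_space
begin

text \<open>Mixed products have expectation zero, so the second moments add up.\<close>

lemma expectation_square_orthogonal_le:
  fixes Y :: "nat \<Rightarrow> 'a \<Rightarrow> real"
  assumes [measurable]: "\<And>s. Y s \<in> borel_measurable M"
    and bound: "\<And>s \<omega>. \<omega> \<in> space M \<Longrightarrow> \<bar>Y s \<omega>\<bar> \<le> K"
    and orth: "\<And>s t. s < t \<Longrightarrow> expectation (\<lambda>\<omega>. Y s \<omega> * Y t \<omega>) = 0"
  shows "expectation (\<lambda>\<omega>. (\<Sum>s<n. Y s \<omega>)\<^sup>2) \<le> real n * K\<^sup>2"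
proof -
  have prod_le: "norm (Y s \<omega> * Y t \<omega>) \<le> K * K" if "\<omega> \<in> space M" for s t \<omega>
    using bound[OF that, of s] bound[OF that, of t] by (simp add: abs_mult mult_mono')
  have int: "integrable M (\<lambda>\<omega>. Y s \<omega> * Y t \<omega>)" for s t
    by (rule integrable_const_bound[of _ "K * K"]) (use prod_le in auto)
  show ?thesis
  proof (induction n)
    case (Suc n)
    have sq: "(\<Sum>s<Suc n. Y s \<omega>)\<^sup>2 =
        (\<Sum>s<n. Y s \<omega>)\<^sup>2 + (2 * (\<Sum>s<n. Y s \<omega> * Y n \<omega>) + Y n \<omega> * Y n \<omega>)" for \<omega>
      by (simp add: power2_sum sum_distrib_right[symmetric] power2_eq_square algebra_simps)
    have int2: "integrable M (\<lambda>\<omega>. (\<Sum>s<n. Y s \<omega>)\<^sup>2)"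
      unfolding power2_eq_square sum_product by (intro Bochner_Integration.integrable_sum int)
    have "expectation (\<lambda>\<omega>. Y n \<omega> * Y n \<omega>) \<le> expectation (\<lambda>\<omega>. K * K)"
      by (rule integral_mono) (use int prod_le[of _ n n] in \<open>auto simp: abs_le_iff\<close>)
    then have "expectation (\<lambda>\<omega>. (\<Sum>s<Suc n. Y s \<omega>)\<^sup>2) \<le> real n * K\<^sup>2 + K\<^sup>2"
      unfolding sq using Suc orth int int2
      by (simp add: integral_add integral_sum prob_space power2_eq_square)
    then show ?case by (simp add: algebra_simps)
  qed simp
qed

text \<open>The second moment of the average is of order \<open>1 / n\<close>, which is summable
  along the squares; between consecutive squares the bound on the terms controls the sum.\<close>

lemma orthogonal_strong_law:
  fixes Y :: "nat \<Rightarrow> 'a \<Rightarrow> real"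
  assumes [measurable]: "\<And>s. Y s \<in> borel_measurable M"
    and bound: "\<And>s \<omega>. \<omega> \<in> space M \<Longrightarrow> \<bar>Y s \<omega>\<bar> \<le> K"
    and orth: "\<And>s t. s < t \<Longrightarrow> expectation (\<lambda>\<omega>. Y s \<omega> * Y t \<omega>) = 0"
  shows "AE \<omega> in M. (\<lambda>n. (\<Sum>s<n. Y s \<omega>) / real n) \<longlonglongrightarrow> 0"
proof -
  define S where "S n \<omega> = (\<Sum>s<n. Y s \<omega>)" for n \<omega>
  have [measurable]: "S n \<in> borel_measurable M" for n
    unfolding S_def by measurable
  \<comment> \<open>\<open>V k\<close> is the squared average of the first \<open>k\<^sup>2\<close>
    terms.\<close>
  define V where "V k \<omega> = (S (k\<^sup>2) \<omega> / (real k)\<^sup>2)\<^sup>2" for k \<omega>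
  have [measurable]: "V k \<in> borel_measurable M" for k
    unfolding V_def by measurable
  obtain \<omega>0 where "\<omega>0 \<in> space M" using not_empty by blast
  with bound[of \<omega>0 0] have K: "0 \<le> K" by linarith
  have S_le: "\<bar>S n \<omega>\<bar> \<le> real n * K" if "\<omega> \<in> space M" for n \<omega>
  proof -
    have "\<bar>S n \<omega>\<bar> \<le> (\<Sum>s<n. \<bar>Y s \<omega>\<bar>)" unfolding S_def by (rule sum_abs)
    also have "\<dots> \<le> (\<Sum>s<n. K)" by (intro sum_mono bound that)
    finally show ?thesis by simp
  qed
  have EV: "(\<integral>\<^sup>+ \<omega>. ennreal (V k \<omega>) \<partial>M) \<le> ennreal (K\<^sup>2 * inverse (real k ^ 2))" for k
  proof -
    have sq: "integrable M (\<lambda>\<omega>. (S n \<omega>)\<^sup>2)" for n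
    proof (rule integrable_const_bound[of _ "(real n * K)\<^sup>2"])
      show "AE \<omega> in M. norm ((S n \<omega>)\<^sup>2) \<le> (real n * K)\<^sup>2"
        using S_le[of _ n] by (auto intro!: AE_I2 simp: abs_le_square_iff[symmetric] K)
    qed simp
    have iV: "integrable M (V k)"
      unfolding V_def power_divide by (intro integrable_divide_zero) (use sq in auto)
    have "expectation (V k) = expectation (\<lambda>\<omega>. (S (k\<^sup>2) \<omega>)\<^sup>2) / real k ^ 4"
      unfolding V_def power_divide by (simp flip: power_mult)
    also have "\<dots> \<le> real (k\<^sup>2) * K\<^sup>2 / real k ^ 4"
      unfolding S_def
      by (intro divide_right_mono expectation_square_orthogonal_le assms) auto
    also have "\<dots> = K\<^sup>2 * inverse (real k ^ 2)"
      \<comment> \<open>At \<open>k = 0\<close> both sides are 0 by the convention for division by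
        zero.\<close>
      by (cases "k = 0") (auto simp: field_simps power2_eq_square power4_eq_xxxx)
    finally have "expectation (V k) \<le> K\<^sup>2 * inverse (real k ^ 2)" .
    then show ?thesis
      using iV by (subst nn_integral_eq_integral) (auto simp: V_def intro: ennreal_leI)
  qed
  have "(\<integral>\<^sup>+ \<omega>. (\<Sum>k. ennreal (V k \<omega>)) \<partial>M) = (\<Sum>k. \<integral>\<^sup>+ \<omega>. ennreal (V k \<omega>) \<partial>M)"
    by (rule nn_integral_suminf) simp
  also have "\<dots> \<le> (\<Sum>k. ennreal (K\<^sup>2 * inverse (real k ^ 2)))"
    by (intro suminf_le EV) auto
  also have "\<dots> < \<infinity>"
    using inverse_power_summable[of 2, where 'a = real]
    by (subst suminf_ennreal2) (auto intro!: summable_mult simp: K)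
  \<comment> \<open>A nonnegative series with finite expected sum converges almost surely, so its
    terms tend to zero.\<close>
  finally have "AE \<omega> in M. (\<Sum>k. ennreal (V k \<omega>)) \<noteq> \<infinity>"
    by (intro nn_integral_PInf_AE) auto
  then show ?thesis
    unfolding S_def[symmetric]
  proof (rule AE_mp, intro AE_I2 impI)
    fix \<omega> assume \<omega>: "\<omega> \<in> space M" and fin: "(\<Sum>k. ennreal (V k \<omega>)) \<noteq> \<infinity>"
    have "summable (\<lambda>k. V k \<omega>)"
      using fin by (intro summable_suminf_not_top) (auto simp: V_def)
    then have "(\<lambda>k. V k \<omega>) \<longlonglongrightarrow> 0"
      by (rule summable_LIMSEQ_zero)
    then have lim: "(\<lambda>k. \<bar>S (k\<^sup>2) \<omega> / (real k)\<^sup>2\<bar>) \<longlonglongrightarrow> 0"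
      unfolding V_def using tendsto_real_sqrt[of _ 0 sequentially] by fastforce
    have sqr: "filterlim (\<lambda>n. floor_sqrt n) at_top sequentially"
      unfolding filterlim_at_top eventually_sequentially
      by (metis le_floor_sqrtI)
    \<comment> \<open>The majorant for general \<open>n\<close>: the average at the largest square
      up to \<open>n\<close>, plus an error for the gap.\<close>
    have lim': "(\<lambda>n. \<bar>S ((floor_sqrt n)\<^sup>2) \<omega> / (real (floor_sqrt n))\<^sup>2\<bar> + 2 * K / real (floor_sqrt n))
        \<longlonglongrightarrow> 0 + 0"
      by (intro tendsto_add filterlim_compose[OF lim sqr]
          filterlim_compose[OF _ sqr, of "\<lambda>k. 2 * K / real k"] lim_const_over_n)
    show "(\<lambda>n. S n \<omega> / real n) \<longlonglongrightarrow> 0"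
    proof (rule Lim_null_comparison)
      show "\<forall>\<^sub>F n in sequentially. norm (S n \<omega> / real n) \<le>
          \<bar>S ((floor_sqrt n)\<^sup>2) \<omega> / (real (floor_sqrt n))\<^sup>2\<bar> + 2 * K / real (floor_sqrt n)"
      proof (rule eventually_sequentiallyI[of 1])
        fix n :: nat assume n: "1 \<le> n"
        define k where "k = floor_sqrt n"
        have k: "k\<^sup>2 \<le> n" "n < (Suc k)\<^sup>2"
          unfolding k_def by (auto simp: Suc_floor_sqrt_power2_gt)
        have k1: "1 \<le> k" unfolding k_def using n by (simp add: Suc_leI)
        have k': "real k ^ 2 \<le> real n" using k(1) by (metis of_nat_le_iff of_nat_power)
        \<comment> \<open>Since \<open>n < (k + 1)\<^sup>2\<close>, at most \<open>2 * k\<close>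
          terms follow the first \<open>k\<^sup>2\<close>, each bounded by \<open>K\<close>.\<close>
        have "\<bar>S n \<omega> - S (k\<^sup>2) \<omega>\<bar> \<le> 2 * K * real k"
        proof -
          have "S n \<omega> - S (k\<^sup>2) \<omega> = (\<Sum>s=k\<^sup>2..<n. Y s \<omega>)"
            unfolding S_def lessThan_atLeast0 using k(1) by (simp add: sum_diff_nat_ivl)
          also have "\<bar>\<dots>\<bar> \<le> (\<Sum>s=k\<^sup>2..<n. \<bar>Y s \<omega>\<bar>)" by (rule sum_abs)
          also have "\<dots> \<le> (\<Sum>s=k\<^sup>2..<n. K)" by (intro sum_mono bound \<omega>)
          also have "\<dots> = real (n - k\<^sup>2) * K" by simp
          also have "\<dots> \<le> real (2 * k) * K"
          proof (intro mult_right_mono K)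
            have "n - k\<^sup>2 \<le> 2 * k" using k by (simp add: power2_eq_square)
            then show "real (n - k\<^sup>2) \<le> real (2 * k)" by (rule of_nat_mono)
          qed
          finally show ?thesis by (simp add: mult_ac)
        qed
        then have "\<bar>S n \<omega>\<bar> \<le> \<bar>S (k\<^sup>2) \<omega>\<bar> + 2 * K * real k" by linarith
        then have "\<bar>S n \<omega>\<bar> / real n \<le> (\<bar>S (k\<^sup>2) \<omega>\<bar> + 2 * K * real k) / real n"
          by (intro divide_right_mono) auto
        also have "\<dots> \<le> (\<bar>S (k\<^sup>2) \<omega>\<bar> + 2 * K * real k) / (real k)\<^sup>2"
          using k' k1 K n by (intro divide_left_mono) auto
        also have "\<dots> = \<bar>S (k\<^sup>2) \<omega> / (real k)\<^sup>2\<bar> + 2 * K / real k"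
          using k1 by (simp add: field_simps power2_eq_square abs_divide)
        finally show "norm (S n \<omega> / real n) \<le>
          \<bar>S ((floor_sqrt n)\<^sup>2) \<omega> / (real (floor_sqrt n))\<^sup>2\<bar> + 2 * K / real (floor_sqrt n)"
          unfolding k_def by (simp add: abs_divide)
      qed
      show "(\<lambda>n. \<bar>S ((floor_sqrt n)\<^sup>2) \<omega> / (real (floor_sqrt n))\<^sup>2\<bar> + 2 * K / real (floor_sqrt n))
          \<longlonglongrightarrow> 0"
        using lim' by simp
    qed
  qed
qed

end


section \<open>The order of the responses\<close>

text \<open>The bound on \<open>m\<close> makes \<open>m - 1\<close> positive, so that every new
  item can take its first response.\<close>

locale revision_design =
  fixes m :: nat and M :: "'w measure" and d :: "nat \<Rightarrow> 'w \<Rightarrow> nat"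
  assumes m_ge: "2 \<le> m" and strategy: "revision_strategy m M d"
begin

section \<open>Counting items and responses\<close>

lemma attempts_0 [simp]: "attempts d 0 i \<omega> = 0"
  by (simp add: attempts_def)

lemma attempts_Suc:
  "attempts d (Suc t) i \<omega> = attempts d t i \<omega> + (if next_item d t \<omega> = i then 1 else 0)"
proof -
  have "{s. s < Suc t \<and> next_item d s \<omega> = i} =
      (if next_item d t \<omega> = i then insert t {s. s < t \<and> next_item d s \<omega> = i}
       else {s. s < t \<and> next_item d s \<omega> = i})"
    by (auto simp: less_Suc_eq)
  then show ?thesis by (simp add: attempts_def)
qed

lemma attempts_mono: "s \<le> t \<Longrightarrow> attempts d s i \<omega> \<le> attempts d t i \<omega>"
  by (rule lift_Suc_mono_le[of "\<lambda>t. attempts d t i \<omega>"]) (auto simp: attempts_Suc)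

lemma items_seen_mono: "s \<le> t \<Longrightarrow> items_seen d s \<omega> \<le> items_seen d t \<omega>"
  by (rule lift_Suc_mono_le[of "\<lambda>t. items_seen d t \<omega>"]) auto

lemma items_seen_le: "items_seen d t \<omega> \<le> t"
  by (induction t) auto

text \<open>The case distinction behind the inductions over time: response \<open>t + 1\<close>
  either opens the next item or goes to a revisable item already seen.\<close>

lemma next_item_cases:
  assumes "\<omega> \<in> space M"
  obtains (new) "next_is_new d t \<omega>" "next_item d t \<omega> = Suc (items_seen d t \<omega>)"
      "items_seen d (Suc t) \<omega> = Suc (items_seen d t \<omega>)"
    | (revision) "\<not> next_is_new d t \<omega>" "1 \<le> t" "next_item d t \<omega> = d t \<omega>" "1 \<le> d t \<omega>"
      "d t \<omega> \<le> items_seen d t \<omega>" "attempts d t (d t \<omega>) \<omega> < m - 1"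
      "items_seen d (Suc t) \<omega> = items_seen d t \<omega>"
proof (cases "next_is_new d t \<omega>")
  case True
  then show ?thesis by (intro new) (auto simp: next_item_def)
next
  case False
  then have "d t \<omega> \<in> revisable m d t \<omega>" "1 \<le> t"
    using strategy assms unfolding revision_strategy_def next_is_new_def by (auto dest!: spec[of _ t])
  with False show ?thesis
    by (intro revision) (auto simp: next_item_def revisable_def)
qed

lemma next_item_range:
  assumes "\<omega> \<in> space M"
  shows "1 \<le> next_item d t \<omega>" and "next_item d t \<omega> \<le> items_seen d (Suc t) \<omega>"
  by (rule next_item_cases[OF assms, of t]; simp)+

lemma attempts_unseen:
  assumes "\<omega> \<in> space M" and "items_seen d t \<omega> < i"
  shows "attempts d t i \<omega> = 0"
proof -
  have "next_item d s \<omega> \<noteq> i" if "s < t" for s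
    using next_item_range(2)[OF assms(1), of s] items_seen_mono[of "Suc s" t \<omega>] that assms(2)
    by linarith
  then show ?thesis by (auto simp: attempts_def)
qed

lemma attempts_pos:
  assumes "\<omega> \<in> space M"
  shows "1 \<le> i \<Longrightarrow> i \<le> items_seen d t \<omega> \<Longrightarrow> 1 \<le> attempts d t i \<omega>"
proof (induction t)
  case (Suc t)
  show ?case
    using Suc by (cases rule: next_item_cases[OF assms, of t]) (auto simp: attempts_Suc le_Suc_eq)
qed simp

lemma attempts_next_less:
  assumes "\<omega> \<in> space M"
  shows "attempts d t (next_item d t \<omega>) \<omega> < m - 1"
  using m_ge by (cases rule: next_item_cases[OF assms, of t]) (auto simp: attempts_unseen[OF assms])

lemma attempts_le:
  assumes "\<omega> \<in> space M"
  shows "attempts d t i \<omega> \<le> m - 1"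
proof (induction t)
  case (Suc t)
  then show ?case using attempts_next_less[OF assms, of t] by (auto simp: attempts_Suc)
qed simp

text \<open>Every response adds exactly one pair of item and position, so a sum over items can be
  read chronologically.\<close>

lemma sum_attempts:
  fixes h :: "nat \<Rightarrow> nat \<Rightarrow> 'b::comm_monoid_add"
  assumes "\<omega> \<in> space M"
  shows "(\<Sum>i=1..items_seen d t \<omega>. \<Sum>j=1..attempts d t i \<omega>. h i j) =
    (\<Sum>s<t. h (next_item d s \<omega>) (Suc (attempts d s (next_item d s \<omega>) \<omega>)))"
proof (induction t)
  case (Suc t)
  let ?N = "next_item d t \<omega>"
  have "(\<Sum>i=1..items_seen d (Suc t) \<omega>. \<Sum>j=1..attempts d (Suc t) i \<omega>. h i j) =
      (\<Sum>i=1..items_seen d (Suc t) \<omega>. (\<Sum>j=1..attempts d t i \<omega>. h i j) +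
        (if ?N = i then h i (Suc (attempts d t i \<omega>)) else 0))"
    by (intro sum.cong refl) (simp add: attempts_Suc)
  also have "\<dots> = (\<Sum>i=1..items_seen d (Suc t) \<omega>. \<Sum>j=1..attempts d t i \<omega>. h i j) +
      h ?N (Suc (attempts d t ?N \<omega>))"
    using next_item_range[OF assms, of t] by (simp add: sum.distrib del: items_seen.simps)
  \<comment> \<open>If response \<open>t + 1\<close> opens an item, the additional inner sum is
    empty, since that item has no earlier response.\<close>
  also have "(\<Sum>i=1..items_seen d (Suc t) \<omega>. \<Sum>j=1..attempts d t i \<omega>. h i j) =
      (\<Sum>i=1..items_seen d t \<omega>. \<Sum>j=1..attempts d t i \<omega>. h i j)"
    using items_seen_mono[of t "Suc t" \<omega>]
    by (intro sum.mono_neutral_right) (auto simp: attempts_unseen[OF assms] simp del: items_seen.simps)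
  finally show ?case using Suc by simp
qed simp

text \<open>Summing the constant 1 counts the responses, and each item receives at most
  \<open>m - 1\<close> of them.\<close>

lemma time_le:
  assumes "\<omega> \<in> space M"
  shows "t \<le> items_seen d t \<omega> * (m - 1)"
proof -
  have "t = (\<Sum>i=1..items_seen d t \<omega>. attempts d t i \<omega>)"
    using sum_attempts[OF assms, where t = t and h = "\<lambda>_ _. 1 :: nat"] by simp
  also have "\<dots> \<le> (\<Sum>i=1..items_seen d t \<omega>. m - 1)"
    by (intro sum_mono attempts_le assms)
  finally show ?thesis by simp
qed

section \<open>Completion times\<close>

lemma completion_time_le:
  "1 \<le> t \<Longrightarrow> d t \<omega> = 0 \<Longrightarrow> completion_time d (items_seen d t \<omega>) \<omega> \<le> t"
  unfolding completion_time_def by (rule Least_le) simp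

text \<open>Item \<open>i\<close> opens only after a decision 0 taken with \<open>i - 1\<close>
  items seen. Its vector, fixed at that completion, is thus known before the item is used.\<close>

lemma item_completion_le:
  "1 < i \<Longrightarrow> i \<le> items_seen d (Suc t) \<omega> \<Longrightarrow> completion_time d (i - 1) \<omega> \<le> t"
proof (induction t)
  case 0
  then show ?case by (simp add: next_is_new_def)
next
  case (Suc t)
  show ?case
  proof (cases "i \<le> items_seen d (Suc t) \<omega>")
    case True
    then show ?thesis using Suc by simp
  next
    case False
    \<comment> \<open>Item \<open>i\<close> is opened by the decision at time \<open>Suc t\<close>,
      which therefore qualifies in the definition of \<open>completion_time\<close>.\<close>
    then have "i - 1 = items_seen d (Suc t) \<omega>" "d (Suc t) \<omega> = 0"
      using Suc.prems by (auto simp: next_is_new_def simp del: items_seen.simps(2)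
          simp: items_seen.simps(2)[of d "Suc t"] split: if_splits)
    then show ?thesis using completion_time_le[of "Suc t" \<omega>] by simp
  qed
qed

text \<open>The minimum defining the completion time ranges over a nonempty set: further items are
  forced once revisions are exhausted.\<close>

lemma completion_time:
  assumes "\<omega> \<in> space M" and "1 \<le> n"
  shows "1 \<le> completion_time d n \<omega>" and "items_seen d (completion_time d n \<omega>) \<omega> = n"
    and "d (completion_time d n \<omega>) \<omega> = 0"
proof -
  \<comment> \<open>With at most \<open>m - 1\<close> responses each, \<open>n\<close> items cannot
    absorb \<open>n * (m - 1) + 1\<close> responses.\<close>
  have "n < items_seen d (Suc (n * (m - 1))) \<omega>"
  proof (rule ccontr)
    assume "\<not> ?thesis"
    then have "items_seen d (Suc (n * (m - 1))) \<omega> * (m - 1) \<le> n * (m - 1)"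
      by (intro mult_le_mono1) simp
    then show False using time_le[OF assms(1), of "Suc (n * (m - 1))"] by linarith
  qed
  \<comment> \<open>The first time with more than \<open>n\<close> items is some
    \<open>Suc t\<close>; at time \<open>t\<close> exactly \<open>n\<close> items are seen and a new
    one is about to open.\<close>
  then have ex: "n < items_seen d (LEAST t. n < items_seen d t \<omega>) \<omega>"
    by (rule LeastI)
  then obtain t where t: "(LEAST t. n < items_seen d t \<omega>) = Suc t"
    by (cases "LEAST t. n < items_seen d t \<omega>") auto
  then have "\<not> n < items_seen d t \<omega>"
    using not_less_Least[of t "\<lambda>t. n < items_seen d t \<omega>"] by simp
  then have "items_seen d t \<omega> = n" "next_is_new d t \<omega>"
    using ex unfolding t by (auto split: if_splits)
  moreover from this have "1 \<le> t" using assms(2) by (cases t) auto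
  ultimately have "\<exists>t. t \<ge> 1 \<and> items_seen d t \<omega> = n \<and> d t \<omega> = 0"
    by (auto simp: next_is_new_def)
  from LeastI_ex[OF this]
  show "1 \<le> completion_time d n \<omega>" "items_seen d (completion_time d n \<omega>) \<omega> = n"
    "d (completion_time d n \<omega>) \<omega> = 0"
    unfolding completion_time_def by auto
qed

lemma completion_time_bounds:
  assumes "\<omega> \<in> space M" and "1 \<le> n"
  shows "n \<le> completion_time d n \<omega>" and "completion_time d n \<omega> \<le> n * (m - 1)"
  using items_seen_le[of "completion_time d n \<omega>" \<omega>] time_le[OF assms(1), of "completion_time d n \<omega>"]
  by (simp_all add: completion_time(2)[OF assms])

end


section \<open>Variables determined by the history\<close>

lemma answers_0 [simp]: "answers X i 0 \<omega> = []"
  by (simp add: answers_def)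

lemma answers_Suc: "answers X i (Suc j) \<omega> = answers X i j \<omega> @ [X i (Suc j) \<omega>]"
  by (simp add: answers_def)

lemma answers_eq_iff:
  "answers X i j \<omega> = answers X i j \<omega>' \<longleftrightarrow> (\<forall>l. 1 \<le> l \<and> l \<le> j \<longrightarrow> X i l \<omega> = X i l \<omega>')"
  unfolding answers_def by (subst map_eq_conv) auto

text \<open>The answers on which the law of response \<open>t + 1\<close> is conditioned. On the
  sample space the list is empty for a new item, so one formula covers both clauses of the
  model.\<close>

definition previous_answers ::
  "(nat \<Rightarrow> 'w \<Rightarrow> nat) \<Rightarrow> (nat \<Rightarrow> nat \<Rightarrow> 'w \<Rightarrow> 'c) \<Rightarrow> nat \<Rightarrow> 'w \<Rightarrow> 'c list" where
  "previous_answers d X t \<omega> =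
     answers X (next_item d t \<omega>) (attempts d t (next_item d t \<omega>) \<omega>) \<omega>"

locale revision_responses = revision_design m M d
  for m :: nat and M :: "'w measure" and d :: "nat \<Rightarrow> 'w \<Rightarrow> nat" +
  fixes X :: "nat \<Rightarrow> nat \<Rightarrow> 'w \<Rightarrow> 'c::finite"
  assumes responses_measurable: "\<And>i j. 1 \<le> i \<Longrightarrow> 1 \<le> j \<Longrightarrow> X i j \<in> measurable M (count_space UNIV)"
begin

text \<open>The decisions alone fix the order of the responses. Those up to time \<open>t\<close>
  also fix the item of response \<open>t + 1\<close>, hence the bounds \<open>Suc t\<close>; the
  value \<open>d 0\<close> is not recorded, hence the exception.\<close>

lemma history_eqD:
  assumes "history d X t \<omega> = history d X t \<omega>'"
  shows "s \<le> Suc t \<Longrightarrow> items_seen d s \<omega> = items_seen d s \<omega>'"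
    and "s \<le> t \<Longrightarrow> d s \<omega> = d s \<omega>' \<or> s = 0"
    and "s \<le> t \<Longrightarrow> next_item d s \<omega> = next_item d s \<omega>'"
    and "s \<le> Suc t \<Longrightarrow> attempts d s i \<omega> = attempts d s i \<omega>'"
proof -
  have d: "d s \<omega> = d s \<omega>'" if "1 \<le> s" "s \<le> t" for s
    using assms that unfolding history_def prod.inject map_eq_conv by auto
  have new: "next_is_new d s \<omega> = next_is_new d s \<omega>'" if "s \<le> t" for s
    using d[of s] that by (cases s) (auto simp: next_is_new_def)
  have seen: "items_seen d s \<omega> = items_seen d s \<omega>'" if "s \<le> Suc t" for s
    using that by (induction s) (auto simp: new)
  have item: "next_item d s \<omega> = next_item d s \<omega>'" if "s \<le> t" for s
    using that d[of s] seen[of s] new[of s] by (auto simp: next_item_def next_is_new_def)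
  have "attempts d s i \<omega> = attempts d s i \<omega>'" if "s \<le> Suc t" for s
    using that by (induction s) (auto simp: attempts_Suc item)
  then show "s \<le> Suc t \<Longrightarrow> items_seen d s \<omega> = items_seen d s \<omega>'"
    and "s \<le> t \<Longrightarrow> d s \<omega> = d s \<omega>' \<or> s = 0"
    and "s \<le> t \<Longrightarrow> next_item d s \<omega> = next_item d s \<omega>'"
    and "s \<le> Suc t \<Longrightarrow> attempts d s i \<omega> = attempts d s i \<omega>'"
    using d new seen item by (auto simp: Suc_le_eq)
qed

lemma history_eq_responses:
  assumes "\<omega> \<in> space M" and "history d X t \<omega> = history d X t \<omega>'"
    and "1 \<le> i" and "1 \<le> j" and "j \<le> attempts d t i \<omega>"
  shows "X i j \<omega> = X i j \<omega>'"
proof -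
  \<comment> \<open>A response that has taken place belongs to an item seen, so its answer list is
    part of the history.\<close>
  have "i \<le> items_seen d t \<omega>"
    using attempts_unseen[OF assms(1), of t i] assms(4,5) by linarith
  moreover have "items_seen d t \<omega> = items_seen d t \<omega>'"
    using history_eqD(1)[OF assms(2)] by simp
  ultimately have "answers X i (attempts d t i \<omega>) \<omega> = answers X i (attempts d t i \<omega>') \<omega>'"
    using assms(2,3) unfolding history_def prod.inject by (simp del: upt_Suc)
  with assms(4,5) history_eqD(4)[OF assms(2), of t i] show ?thesis
    by (simp add: answers_eq_iff)
qed

lemma history_eq_mono:
  assumes "\<omega> \<in> space M" and "history d X t \<omega> = history d X t \<omega>'" and "s \<le> t"
  shows "history d X s \<omega> = history d X s \<omega>'"
proof -
  have "answers X i (attempts d s i \<omega>) \<omega> = answers X i (attempts d s i \<omega>) \<omega>'" if "1 \<le> i" for i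
    unfolding answers_eq_iff
    using history_eq_responses[OF assms(1,2) that] attempts_mono[OF assms(3), of i \<omega>] by auto
  then show ?thesis
    using history_eqD(1,2,4)[OF assms(2)] assms(3) unfolding history_def prod.inject
    by (auto simp del: upt_Suc) (metis Suc_le_eq less_Suc_eq_le less_irrefl order_trans zero_less_Suc)
qed

text \<open>Polymorphic in the codomain, so lists, items and reals are treated alike before any
  sigma-algebra is chosen on them.\<close>

definition determined :: "nat \<Rightarrow> ('w \<Rightarrow> 'b) \<Rightarrow> bool" where
  "determined t f \<longleftrightarrow>
     (\<forall>\<omega>\<in>space M. \<forall>\<omega>'\<in>space M. history d X t \<omega> = history d X t \<omega>' \<longrightarrow> f \<omega> = f \<omega>')"

lemma determined_mono: "determined s f \<Longrightarrow> s \<le> t \<Longrightarrow> determined t f"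
  unfolding determined_def using history_eq_mono by blast

lemma determined_previous_answers: "determined t (previous_answers d X t)"
  unfolding determined_def
proof (intro ballI impI)
  fix \<omega> \<omega>' assume \<omega>: "\<omega> \<in> space M" and H: "history d X t \<omega> = history d X t \<omega>'"
  have "next_item d t \<omega>' = next_item d t \<omega>" "attempts d t i \<omega>' = attempts d t i \<omega>" for i
    using history_eqD(3,4)[OF H, of t] by auto
  then show "previous_answers d X t \<omega> = previous_answers d X t \<omega>'"
    unfolding previous_answers_def
    using history_eq_responses[OF \<omega> H next_item_range(1)[OF \<omega>]] by (simp add: answers_eq_iff)
qed

text \<open>Response \<open>t + 1\<close> is recorded only in the history at time
  \<open>Suc t\<close>.\<close>

lemma determined_next_response: "determined (Suc t) (next_response d X t)"
  unfolding determined_def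
proof (intro ballI impI)
  fix \<omega> \<omega>' assume \<omega>: "\<omega> \<in> space M" and H: "history d X (Suc t) \<omega> = history d X (Suc t) \<omega>'"
  have "next_item d t \<omega>' = next_item d t \<omega>" "attempts d t i \<omega>' = attempts d t i \<omega>" for i
    using history_eqD(3,4)[OF H, of t] by auto
  then show "next_response d X t \<omega> = next_response d X t \<omega>'"
    unfolding next_response_def
    using history_eq_responses[OF \<omega> H next_item_range(1)[OF \<omega>, of t],
        of "attempts d t (next_item d t \<omega>) \<omega> + 1"]
    by (simp add: Let_def attempts_Suc)
qed

section \<open>Measurability of the history\<close>

lemma next_item_measurable: "next_item d t \<in> measurable M (count_space UNIV)"
  and items_seen_measurable: "items_seen d t \<in> measurable M (count_space UNIV)"
proof -
  have [measurable]: "d t \<in> measurable M (count_space UNIV)" if "1 \<le> t" for t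
    using strategy that by (auto simp: revision_strategy_def)
  have [measurable]: "Measurable.pred M (next_is_new d t)" for t
    \<comment> \<open>Nothing is assumed about \<open>d 0\<close>, but at time 0 the predicate is
      constantly true.\<close>
    by (cases "t = 0") (auto simp: next_is_new_def[abs_def])
  show [measurable]: "items_seen d t \<in> measurable M (count_space UNIV)" for t
    by (induction t) auto
  show "next_item d t \<in> measurable M (count_space UNIV)"
  proof (cases "t = 0")
    case True
    then show ?thesis by (simp add: next_item_def[abs_def] next_is_new_def)
  next
    case False
    then have "d t \<in> measurable M (count_space UNIV)" by simp
    then show ?thesis by (simp add: next_item_def[abs_def])
  qed
qed

lemma attempts_measurable [measurable]:
  "attempts d t i \<in> measurable M (count_space UNIV)"
proof (induction t)
  case (Suc t)
  note [measurable] = Suc next_item_measurable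
  show ?case unfolding attempts_Suc[abs_def] by measurable
qed (simp add: attempts_def)

lemma map_measurable:
  fixes f :: "nat \<Rightarrow> 'w \<Rightarrow> 'b::countable"
  assumes "\<And>i. i \<in> set is \<Longrightarrow> f i \<in> measurable M (count_space UNIV)"
  shows "(\<lambda>\<omega>. map (\<lambda>i. f i \<omega>) is) \<in> measurable M (count_space UNIV)"
  using assms
proof (induction "is")
  case (Cons i "is")
  then have [measurable]: "f i \<in> measurable M (count_space UNIV)"
    "(\<lambda>\<omega>. map (\<lambda>i. f i \<omega>) is) \<in> measurable M (count_space UNIV)" by auto
  have "(\<lambda>\<omega>. f i \<omega> # map (\<lambda>i. f i \<omega>) is) \<in> measurable M (count_space UNIV)"
    by (rule measurable_compose_countable[where g = "f i" and f = "\<lambda>y \<omega>. y # map (\<lambda>i. f i \<omega>) is"])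
      measurable
  then show ?case by simp
qed simp

text \<open>Splitting over the countably many values of \<open>f\<close> gives measurability for the
  full power set of the product type.\<close>

lemma pair_measurable:
  fixes f :: "'w \<Rightarrow> 'a::countable"
  assumes "f \<in> measurable M (count_space UNIV)" and g: "g \<in> measurable M (count_space UNIV)"
  shows "(\<lambda>\<omega>. (f \<omega>, g \<omega>)) \<in> measurable M (count_space UNIV)"
  by (rule measurable_compose_countable[where g = f and f = "\<lambda>y \<omega>. (y, g \<omega>)",
        OF measurable_compose[OF g] assms(1)]) simp

lemma history_measurable: "history d X t \<in> measurable M (count_space UNIV)"
proof -
  have "(\<lambda>\<omega>. answers X i j \<omega>) \<in> measurable M (count_space UNIV)" if "1 \<le> i" for i j
    unfolding answers_def using that by (intro map_measurable responses_measurable) auto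
  \<comment> \<open>Lists of random length are handled by splitting over the countably many possible
    lengths.\<close>
  then have "(\<lambda>\<omega>. answers X i (attempts d t i \<omega>) \<omega>) \<in> measurable M (count_space UNIV)" if "1 \<le> i" for i
    by (rule measurable_compose_countable[where g = "attempts d t i" and f = "\<lambda>j \<omega>. answers X i j \<omega>"])
      (use that in auto)
  then have "(\<lambda>\<omega>. map (\<lambda>i. answers X i (attempts d t i \<omega>) \<omega>) [1..<Suc n]) \<in>
      measurable M (count_space UNIV)" for n
    by (intro map_measurable) auto
  then have "(\<lambda>\<omega>. map (\<lambda>i. answers X i (attempts d t i \<omega>) \<omega>) [1..<Suc (items_seen d t \<omega>)])
      \<in> measurable M (count_space UNIV)"
    by (rule measurable_compose_countable[where g = "items_seen d t" and
          f = "\<lambda>n \<omega>. map (\<lambda>i. answers X i (attempts d t i \<omega>) \<omega>) [1..<Suc n]", OF _ items_seen_measurable])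
  moreover have "(\<lambda>\<omega>. map (\<lambda>s. items_seen d s \<omega>) [1..<Suc t]) \<in> measurable M (count_space UNIV)"
    by (intro map_measurable items_seen_measurable)
  moreover have "(\<lambda>\<omega>. map (\<lambda>s. d s \<omega>) [1..<Suc t]) \<in> measurable M (count_space UNIV)"
    using strategy by (intro map_measurable) (auto simp: revision_strategy_def)
  ultimately show ?thesis
    unfolding history_def[abs_def] by (intro pair_measurable)
qed

section \<open>The filtration generated by the histories\<close>

lemma space_hist_algebra: "space (hist_algebra M d X t) = space M"
  by (simp add: hist_algebra_def)

lemma sets_hist_algebra: "sets (hist_algebra M d X t) = {history d X t -` C \<inter> space M |C. True}"
  unfolding hist_algebra_def by (subst sets_vimage_algebra2) simp_all

lemma sets_hist_algebra_iff:
  "A \<in> sets (hist_algebra M d X t) \<longleftrightarrow> A \<subseteq> space M \<and> determined t (\<lambda>\<omega>. \<omega> \<in> A)"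
proof
  assume "A \<in> sets (hist_algebra M d X t)"
  then obtain C where "A = history d X t -` C \<inter> space M"
    unfolding sets_hist_algebra by blast
  then show "A \<subseteq> space M \<and> determined t (\<lambda>\<omega>. \<omega> \<in> A)"
    by (simp add: determined_def)
next
  assume A: "A \<subseteq> space M \<and> determined t (\<lambda>\<omega>. \<omega> \<in> A)"
  have "\<omega> \<in> A" if "\<omega> \<in> space M" "\<omega>' \<in> A" "history d X t \<omega> = history d X t \<omega>'" for \<omega> \<omega>'
    using A that unfolding determined_def by blast
  \<comment> \<open>A set that is a union of fibres of the history is the preimage of its own
    image.\<close>
  with A have "A = history d X t -` (history d X t ` A) \<inter> space M"
    by (intro equalityI subsetI) (blast, elim IntE vimageE imageE, blast)
  then show "A \<in> sets (hist_algebra M d X t)"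
    unfolding sets_hist_algebra by blast
qed

text \<open>All determined subsets of the sample space are measurable, so the target sigma-algebra
  may be arbitrary.\<close>

lemma determined_measurable:
  assumes "determined t f" and "f \<in> space M \<rightarrow> space N"
  shows "f \<in> measurable (hist_algebra M d X t) N"
proof (rule measurableI)
  fix A assume "A \<in> sets N"
  show "f -` A \<inter> space (hist_algebra M d X t) \<in> sets (hist_algebra M d X t)"
    unfolding sets_hist_algebra_iff space_hist_algebra
    unfolding determined_def
  proof (intro conjI ballI impI)
    fix \<omega> \<omega>'
    assume *: "\<omega> \<in> space M" "\<omega>' \<in> space M" and "history d X t \<omega> = history d X t \<omega>'"
    then have "f \<omega> = f \<omega>'"
      using assms(1) unfolding determined_def by blast
    with * show "(\<omega> \<in> f -` A \<inter> space M) = (\<omega>' \<in> f -` A \<inter> space M)" by simp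
  qed simp
qed (use assms(2) in \<open>auto simp: space_hist_algebra\<close>)

lemma subalgebra_hist_algebra: "subalgebra M (hist_algebra M d X t)"
  unfolding subalgebra_def
proof (intro conjI subsetI)
  fix A assume "A \<in> sets (hist_algebra M d X t)"
  then obtain C where "A = history d X t -` C \<inter> space M"
    unfolding sets_hist_algebra by blast
  then show "A \<in> sets M"
    using measurable_sets[OF history_measurable, of C t] by simp
qed (simp add: space_hist_algebra)

lemma filtration_hist_algebra: "filtration (space M) (hist_algebra M d X)"
proof
  show "sets (hist_algebra M d X s) \<le> sets (hist_algebra M d X t)" if "s \<le> t" for s t
    using determined_mono[OF _ that] by (auto simp: sets_hist_algebra_iff)
qed (rule space_hist_algebra)

lemma stopping_time_completion_time:
  assumes "1 \<le> n"
  shows "stopping_time (hist_algebra M d X) (completion_time d n)"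
proof
  fix t
  \<comment> \<open>The forward direction relies on the existence of a completion time; the
    right-hand side can be read off the history at time \<open>t\<close>.\<close>
  have le_iff: "completion_time d n \<omega> \<le> t \<longleftrightarrow> (\<exists>s\<le>t. 1 \<le> s \<and> items_seen d s \<omega> = n \<and> d s \<omega> = 0)"
    if "\<omega> \<in> space M" for \<omega>
    using completion_time[OF that assms] completion_time_le[of _ \<omega>] by (metis order_trans)
  have "determined t (\<lambda>\<omega>. completion_time d n \<omega> \<le> t)"
    unfolding determined_def
  proof (intro ballI impI)
    fix \<omega> \<omega>'
    assume *: "\<omega> \<in> space M" "\<omega>' \<in> space M" and H: "history d X t \<omega> = history d X t \<omega>'"
    have "(s \<le> t \<and> 1 \<le> s \<and> items_seen d s \<omega> = n \<and> d s \<omega> = 0) \<longleftrightarrow>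
        (s \<le> t \<and> 1 \<le> s \<and> items_seen d s \<omega>' = n \<and> d s \<omega>' = 0)" for s
      using history_eqD(1,2)[OF H, of s] by auto
    then show "(completion_time d n \<omega> \<le> t) = (completion_time d n \<omega>' \<le> t)"
      unfolding le_iff[OF *(1)] le_iff[OF *(2)] by blast
  qed
  then show "Measurable.pred (hist_algebra M d X t) (\<lambda>\<omega>. completion_time d n \<omega> \<le> t)"
    by (rule determined_measurable) simp
qed

text \<open>Singletons are measurable in a \<open>T\<^sub>1\<close> space, and membership in a set of \<open>\<F>\<^bsub>T\<^esub>\<close> can be read off the
  history at time \<open>t\<close> as soon as \<open>T \<le> t\<close>.\<close>

lemma pre_sigma_constant:
  fixes f :: "'w \<Rightarrow> 'b::t1_space"
  assumes "stopping_time (hist_algebra M d X) T"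
    and "f \<in> borel_measurable (filtration.pre_sigma (space M) (hist_algebra M d X) T)"
    and "\<omega> \<in> space M" and "\<omega>' \<in> space M" and "T \<omega> \<le> t"
    and "history d X t \<omega> = history d X t \<omega>'"
  shows "f \<omega> = f \<omega>'"
proof -
  interpret filtration "space M" "hist_algebra M d X" by (rule filtration_hist_algebra)
  define A where "A = f -` {f \<omega>} \<inter> space M"
  have "A \<in> sets (pre_sigma T)"
    using measurable_sets[OF assms(2), of "{f \<omega>}"] by (simp add: A_def space_pre_sigma)
  then have "{\<omega>\<in>A. T \<omega> \<le> t} \<in> sets (hist_algebra M d X t)"
    by (rule sets_pre_sigmaD[OF assms(1)])
  then have "\<omega>' \<in> A"
    using assms(3-6) unfolding sets_hist_algebra_iff determined_def A_def by auto
  then show ?thesis by (simp add: A_def)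
qed

end


section \<open>The score along the responses\<close>

locale revision_test = revision_responses m M d X + prob_space M
  for m :: nat and M :: "'w measure" and d :: "nat \<Rightarrow> 'w \<Rightarrow> nat"
    and X :: "nat \<Rightarrow> nat \<Rightarrow> 'w \<Rightarrow> 'k::finite option" +
  fixes \<theta> :: real and B :: "'k item set" and b :: "nat \<Rightarrow> 'w \<Rightarrow> 'k item"
  assumes compact_B: "compact B"
    and nondegenerate: "\<And>\<beta>. \<beta> \<in> B \<Longrightarrow> nondegenerate_item \<beta>"
    and selection: "item_selection_strategy M d X B b"
    and responses: "nominal_responses M \<theta> d X b"
begin

definition current_item :: "nat \<Rightarrow> 'w \<Rightarrow> 'k item" where
  "current_item t \<omega> = b (next_item d t \<omega>) \<omega>"

text \<open>The contribution of response \<open>t + 1\<close> to the score; at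
  \<open>\<theta>\<close> these are martingale differences with respect to the histories.\<close>

definition response_score :: "real \<Rightarrow> nat \<Rightarrow> 'w \<Rightarrow> real" where
  "response_score x t \<omega> =
     item_score x (current_item t \<omega>) (next_response d X t \<omega>) (previous_answers d X t \<omega>)"

lemma item_in_B: "\<omega> \<in> space M \<Longrightarrow> 1 \<le> i \<Longrightarrow> b i \<omega> \<in> B"
  using selection by (auto simp: item_selection_strategy_def)

lemma current_item_in_B: "\<omega> \<in> space M \<Longrightarrow> current_item t \<omega> \<in> B"
  unfolding current_item_def by (intro item_in_B next_item_range)

text \<open>A general summand \<open>h\<close> lets the same rearrangement serve the score and the
  information.\<close>

lemma sum_attempts_item:
  fixes h :: "real \<Rightarrow> 'k item \<Rightarrow> 'k option \<Rightarrow> 'k option list \<Rightarrow> real"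
  assumes "\<omega> \<in> space M"
  shows "(\<Sum>i=1..items_seen d t \<omega>. h x (b i \<omega>) (X i 1 \<omega>) [] +
        (\<Sum>j=2..attempts d t i \<omega>. h x (b i \<omega>) (X i j \<omega>) (answers X i (j - 1) \<omega>))) =
    (\<Sum>s<t. h x (current_item s \<omega>) (next_response d X s \<omega>) (previous_answers d X s \<omega>))"
proof -
  \<comment> \<open>Every item seen has a first response, whose list of previous answers is
    \<open>answers X i 0\<close>, that is, empty.\<close>
  have "(\<Sum>j=1..attempts d t i \<omega>. h x (b i \<omega>) (X i j \<omega>) (answers X i (j - 1) \<omega>)) =
      h x (b i \<omega>) (X i 1 \<omega>) [] +
        (\<Sum>j=2..attempts d t i \<omega>. h x (b i \<omega>) (X i j \<omega>) (answers X i (j - 1) \<omega>))"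
    if "i \<in> {1..items_seen d t \<omega>}" for i
    using attempts_pos[OF assms, of i t] that
    by (subst sum.atLeast_Suc_atMost) (auto simp: numeral_2_eq_2)
  then have "(\<Sum>i=1..items_seen d t \<omega>. h x (b i \<omega>) (X i 1 \<omega>) [] +
        (\<Sum>j=2..attempts d t i \<omega>. h x (b i \<omega>) (X i j \<omega>) (answers X i (j - 1) \<omega>))) =
      (\<Sum>i=1..items_seen d t \<omega>. \<Sum>j=1..attempts d t i \<omega>.
        h x (b i \<omega>) (X i j \<omega>) (answers X i (j - 1) \<omega>))"
    by (intro sum.cong refl) simp
  then show ?thesis
    by (simp only: sum_attempts[OF assms] current_item_def next_response_def previous_answers_def
        Let_def diff_Suc_1 Suc_eq_plus1[symmetric])
qed

lemma total_score_eq_sum: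
  "\<omega> \<in> space M \<Longrightarrow> total_score d X b t x \<omega> = (\<Sum>s<t. response_score x s \<omega>)"
  unfolding total_score_def response_score_def by (rule sum_attempts_item)

lemma total_info_eq_sum:
  "\<omega> \<in> space M \<Longrightarrow>
    total_info d X b t x \<omega> = (\<Sum>s<t. item_info x (current_item s \<omega>) (previous_answers d X s \<omega>))"
  unfolding total_info_def revision_info_def sum.distrib[symmetric]
  by (rule sum_attempts_item[where h = "\<lambda>x \<beta> k xs. item_info x \<beta> xs"])

text \<open>The first item is deterministic. A later one is fixed at the completion of its
  predecessors, which is no later than \<open>t\<close>.\<close>

lemma determined_current_item: "determined t (current_item t)"
  unfolding determined_def
proof (intro ballI impI)
  fix \<omega> \<omega>'
  assume \<omega>: "\<omega> \<in> space M" "\<omega>' \<in> space M" and H: "history d X t \<omega> = history d X t \<omega>'"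
  define i where "i = next_item d t \<omega>"
  have i: "1 \<le> i" "i \<le> items_seen d (Suc t) \<omega>"
    unfolding i_def by (fact next_item_range[OF \<omega>(1)])+
  have "b i \<omega> = b i \<omega>'"
  proof (cases "i = 1")
    case True
    then show ?thesis
      using selection \<omega> by (auto simp: item_selection_strategy_def)
  next
    case False
    with i have "1 < i" by simp
    then have "b (i - 1 + 1) \<in> borel_measurable
        (filtration.pre_sigma (space M) (hist_algebra M d X) (completion_time d (i - 1)))"
      using selection unfolding item_selection_strategy_def by (metis less_diff_conv less_imp_le_nat add_0
          One_nat_def Suc_leI zero_less_diff)
    then show ?thesis
      using \<open>1 < i\<close> \<omega> H item_completion_le[of i t \<omega>] i(2)
      by (intro pre_sigma_constant[OF stopping_time_completion_time[of "i - 1"]]) auto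
  qed
  moreover have "next_item d t \<omega>' = i"
    using history_eqD(3)[OF H, of t] by (simp add: i_def)
  ultimately show "current_item t \<omega> = current_item t \<omega>'"
    by (simp add: current_item_def i_def)
qed

lemma determined_response_score: "determined (Suc t) (response_score x t)"
  using determined_mono[OF determined_current_item[of t], of "Suc t"]
    determined_mono[OF determined_previous_answers[of t], of "Suc t"] determined_next_response[of t]
  unfolding determined_def response_score_def by (metis le_add2 plus_1_eq_Suc)

lemma determined_borel:
  fixes f :: "'w \<Rightarrow> real"
  assumes "determined t f"
  shows "f \<in> borel_measurable (hist_algebra M d X t)" and "f \<in> borel_measurable M"
  using determined_measurable[OF assms, of borel] measurable_from_subalg[OF subalgebra_hist_algebra]
  by auto

section \<open>The conditional law of a response and the orthogonality of the scores\<close>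

lemma next_response_notin:
  assumes "\<omega> \<in> space M"
  shows "next_response d X t \<omega> \<notin> set (previous_answers d X t \<omega>)"
proof -
  let ?i = "next_item d t \<omega>"
  \<comment> \<open>After response \<open>t + 1\<close> the list ends with it, so distinctness at
    time \<open>Suc t\<close> excludes a repetition.\<close>
  have "\<forall>i\<in>{1..items_seen d (Suc t) \<omega>}. distinct (answers X i (attempts d (Suc t) i \<omega>) \<omega>)"
    using responses assms unfolding nominal_responses_def by (simp del: items_seen.simps)
  then have "distinct (answers X ?i (attempts d (Suc t) ?i \<omega>) \<omega>)"
    using next_item_range[OF assms, of t] by (simp del: items_seen.simps)
  then show ?thesis
    by (simp add: attempts_Suc answers_Suc next_response_def previous_answers_def Let_def)
qed

lemma next_response_law:
  "AE \<omega> in M. k \<notin> set (previous_answers d X t \<omega>) \<longrightarrow>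
     real_cond_exp M (hist_algebra M d X t)
       (indicat_real {\<omega>'\<in>space M. next_response d X t \<omega>' = k}) \<omega>
     = cond_prob_cat \<theta> (current_item t \<omega>) (previous_answers d X t \<omega>) k"
proof -
  have revision: "\<forall>t\<ge>1. \<forall>i\<ge>1. \<forall>k. AE \<omega> in M.
      d t \<omega> = i \<and> k \<notin> set (answers X i (attempts d t i \<omega>) \<omega>) \<longrightarrow>
      real_cond_exp M (hist_algebra M d X t)
        (indicat_real {\<omega>'\<in>space M. next_response d X t \<omega>' = k}) \<omega>
      = cond_prob_cat \<theta> (b i \<omega>) (answers X i (attempts d t i \<omega>) \<omega>) k"
    using responses unfolding nominal_responses_def by (elim conjE)
  \<comment> \<open>Each fixed item has its own null set; countably many are merged so that the
    random item \<open>d t \<omega>\<close> can be inserted.\<close>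
  have "AE \<omega> in M. \<forall>i. 1 \<le> i \<and> 1 \<le> t \<longrightarrow>
      d t \<omega> = i \<and> k \<notin> set (answers X i (attempts d t i \<omega>) \<omega>) \<longrightarrow>
      real_cond_exp M (hist_algebra M d X t)
        (indicat_real {\<omega>'\<in>space M. next_response d X t \<omega>' = k}) \<omega>
      = cond_prob_cat \<theta> (b i \<omega>) (answers X i (attempts d t i \<omega>) \<omega>) k"
    unfolding AE_all_countable
  proof (rule allI)
    show "AE \<omega> in M. 1 \<le> i \<and> 1 \<le> t \<longrightarrow>
        d t \<omega> = i \<and> k \<notin> set (answers X i (attempts d t i \<omega>) \<omega>) \<longrightarrow>
        real_cond_exp M (hist_algebra M d X t)
          (indicat_real {\<omega>'\<in>space M. next_response d X t \<omega>' = k}) \<omega>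
        = cond_prob_cat \<theta> (b i \<omega>) (answers X i (attempts d t i \<omega>) \<omega>) k" for i
      using revision by (cases "1 \<le> i \<and> 1 \<le> t") simp_all
  qed
  moreover have "AE \<omega> in M. next_is_new d t \<omega> \<longrightarrow>
      real_cond_exp M (hist_algebra M d X t)
        (indicat_real {\<omega>'\<in>space M. next_response d X t \<omega>' = k}) \<omega>
      = cat_prob \<theta> (b (items_seen d t \<omega> + 1) \<omega>) k"
    using responses by (simp add: nominal_responses_def)
  ultimately show ?thesis
    using AE_space
  proof eventually_elim
    case (elim \<omega>)
    show ?case
    proof (cases rule: next_item_cases[OF elim(3), of t])
      case 1
      then show ?thesis
        using elim(2) attempts_unseen[OF elim(3), of t "Suc (items_seen d t \<omega>)"]
        by (simp add: previous_answers_def current_item_def cond_prob_cat_Nil)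
    next
      case 2
      then show ?thesis
        using elim(1) by (simp add: previous_answers_def current_item_def)
    qed
  qed
qed

lemma response_score_bounded:
  obtains K where "\<And>x t \<omega>. \<omega> \<in> space M \<Longrightarrow> \<bar>response_score x t \<omega>\<bar> \<le> K"
  using item_score_bounded[OF compact_B] current_item_in_B unfolding response_score_def by metis

text \<open>Given the history, only the response is random. Splitting by its value replaces
  indicators by conditional probabilities, and the conditional mean of the score is zero.\<close>

lemma response_score_orthogonal:
  assumes "determined t Z" and "\<And>\<omega>. \<omega> \<in> space M \<Longrightarrow> \<bar>Z \<omega>\<bar> \<le> C"
  shows "expectation (\<lambda>\<omega>. Z \<omega> * response_score \<theta> t \<omega>) = 0"
proof -
  interpret finite_measure_subalgebra M "hist_algebra M d X t"
    by unfold_locales (rule subalgebra_hist_algebra)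
  obtain K where K: "\<And>x \<beta> k xs. \<beta> \<in> B \<Longrightarrow> \<bar>item_score x \<beta> k xs\<bar> \<le> K"
    using item_score_bounded[OF compact_B] by blast
  define c where "c \<omega> = current_item t \<omega>" for \<omega>
  define p where "p \<omega> = previous_answers d X t \<omega>" for \<omega>
  \<comment> \<open>Zero on categories already used: the law is silent about them and the response
    never falls there.\<close>
  define \<phi> where "\<phi> k \<omega> = (if k \<in> set (p \<omega>) then 0 else Z \<omega> * item_score \<theta> (c \<omega>) k (p \<omega>))" for k \<omega>
  define R where "R k = indicat_real {\<omega>'\<in>space M. next_response d X t \<omega>' = k}" for k
  define E where "E k = real_cond_exp M (hist_algebra M d X t) (R k)" for k
  have det_\<phi>: "determined t (\<phi> k)" and det_q: "determined t (\<lambda>\<omega>. \<phi> k \<omega> * cond_prob_cat \<theta> (c \<omega>) (p \<omega>) k)"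
    for k
    using assms(1) determined_current_item[of t] determined_previous_answers[of t]
    unfolding determined_def \<phi>_def c_def p_def by metis+
  have R: "R k \<in> borel_measurable M" for k
  proof (rule determined_borel(2)[of "Suc t"])
    show "determined (Suc t) (R k)"
      unfolding determined_def
    proof (intro ballI impI)
      fix \<omega> \<omega>'
      assume *: "\<omega> \<in> space M" "\<omega>' \<in> space M" and "history d X (Suc t) \<omega> = history d X (Suc t) \<omega>'"
      then have "next_response d X t \<omega> = next_response d X t \<omega>'"
        using determined_next_response[of t] unfolding determined_def by blast
      with * show "R k \<omega> = R k \<omega>'" by (simp add: R_def indicator_def)
    qed
  qed
  have bound: "norm (\<phi> k \<omega> * R k \<omega>) \<le> C * K" if "\<omega> \<in> space M" for k \<omega>
  proof -
    have "\<bar>\<phi> k \<omega>\<bar> \<le> C * K"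
      using assms(2)[OF that] K[OF current_item_in_B[OF that], of \<theta> t k "p \<omega>"]
      unfolding \<phi>_def c_def by (auto simp: abs_mult intro!: mult_mono' mult_nonneg_nonneg)
    moreover have "0 \<le> C * K" using calculation by linarith
    ultimately show ?thesis by (simp add: R_def indicator_def)
  qed
  have int: "integrable M (\<lambda>\<omega>. \<phi> k \<omega> * R k \<omega>)" for k
    by (rule integrable_const_bound[of _ "C * K"])
      (use bound R determined_borel(2)[OF det_\<phi>] in \<open>auto intro: AE_I2\<close>)
  \<comment> \<open>A factor known at time \<open>t\<close> pulls out of the conditional
    expectation, so \<open>R k\<close> may be replaced by \<open>E k\<close> under the
    integral.\<close>
  note E = real_cond_exp_intg[OF int determined_borel(1)[OF det_\<phi>] R, folded E_def]
  have AE_E: "AE \<omega> in M. \<phi> k \<omega> * E k \<omega> = \<phi> k \<omega> * cond_prob_cat \<theta> (c \<omega>) (p \<omega>) k" for k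
    using next_response_law[of k t] unfolding E_def R_def c_def p_def
    by eventually_elim (auto simp: \<phi>_def p_def)
  have meas_E: "(\<lambda>\<omega>. \<phi> k \<omega> * E k \<omega>) \<in> borel_measurable M" for k
    using E(1) by (rule borel_measurable_integrable)
  have int_q: "integrable M (\<lambda>\<omega>. \<phi> k \<omega> * cond_prob_cat \<theta> (c \<omega>) (p \<omega>) k)" for k
    using E(1) integrable_cong_AE[OF meas_E determined_borel(2)[OF det_q] AE_E] by blast
  have "expectation (\<lambda>\<omega>. Z \<omega> * response_score \<theta> t \<omega>) = expectation (\<lambda>\<omega>. \<Sum>k\<in>UNIV. \<phi> k \<omega> * R k \<omega>)"
  proof (intro Bochner_Integration.integral_cong refl)
    fix \<omega> assume \<omega>: "\<omega> \<in> space M"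
    \<comment> \<open>Only the indicator of the actual response is nonzero.\<close>
    have "(\<Sum>k\<in>UNIV. \<phi> k \<omega> * R k \<omega>) = (\<Sum>k\<in>UNIV. if k = next_response d X t \<omega> then \<phi> k \<omega> else 0)"
      using \<omega> by (intro sum.cong refl) (simp add: R_def indicator_def)
    then show "Z \<omega> * response_score \<theta> t \<omega> = (\<Sum>k\<in>UNIV. \<phi> k \<omega> * R k \<omega>)"
      using next_response_notin[OF \<omega>, of t] by (simp add: \<phi>_def response_score_def c_def p_def)
  qed
  also have "\<dots> = (\<Sum>k\<in>UNIV. expectation (\<lambda>\<omega>. \<phi> k \<omega> * cond_prob_cat \<theta> (c \<omega>) (p \<omega>) k))"
    by (simp add: Bochner_Integration.integral_sum int flip: E(2))
       (intro sum.cong refl integral_cong_AE meas_E determined_borel(2)[OF det_q] AE_E)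
  also have "\<dots> = expectation (\<lambda>\<omega>. \<Sum>k\<in>UNIV. \<phi> k \<omega> * cond_prob_cat \<theta> (c \<omega>) (p \<omega>) k)"
    by (simp add: Bochner_Integration.integral_sum int_q)
  also have "(\<lambda>\<omega>. \<Sum>k\<in>UNIV. \<phi> k \<omega> * cond_prob_cat \<theta> (c \<omega>) (p \<omega>) k) = (\<lambda>\<omega>. 0)"
  proof
    fix \<omega>
    have "(\<Sum>k\<in>UNIV. \<phi> k \<omega> * cond_prob_cat \<theta> (c \<omega>) (p \<omega>) k) =
        (\<Sum>k\<in>- set (p \<omega>). Z \<omega> * (item_score \<theta> (c \<omega>) k (p \<omega>) * cond_prob_cat \<theta> (c \<omega>) (p \<omega>) k))"
      by (rule sum.mono_neutral_cong_right) (auto simp: \<phi>_def)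
    then show "(\<Sum>k\<in>UNIV. \<phi> k \<omega> * cond_prob_cat \<theta> (c \<omega>) (p \<omega>) k) = 0"
      by (simp add: mean_item_score flip: sum_distrib_left)
  qed
  finally show ?thesis by simp
qed

lemma score_strong_law:
  "AE \<omega> in M. (\<lambda>t. total_score d X b t \<theta> \<omega> / real t) \<longlonglongrightarrow> 0"
proof -
  obtain K where K: "\<And>x t \<omega>. \<omega> \<in> space M \<Longrightarrow> \<bar>response_score x t \<omega>\<bar> \<le> K"
    using response_score_bounded by blast
  have "AE \<omega> in M. (\<lambda>n. (\<Sum>s<n. response_score \<theta> s \<omega>) / real n) \<longlonglongrightarrow> 0"
  proof (rule orthogonal_strong_law)
    show "response_score \<theta> s \<in> borel_measurable M" for s
      by (rule determined_borel(2)[OF determined_response_score])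
    \<comment> \<open>For \<open>s < t\<close> the score of response \<open>s + 1\<close> is already
      known at time \<open>s + 1\<close>, hence at time \<open>t\<close>.\<close>
    show "expectation (\<lambda>\<omega>. response_score \<theta> s \<omega> * response_score \<theta> t \<omega>) = 0" if "s < t" for s t
      using that K by (intro response_score_orthogonal determined_mono[OF determined_response_score]) auto
  qed (fact K)
  then show ?thesis
    using AE_space by eventually_elim (simp add: total_score_eq_sum)
qed


section \<open>Consistency\<close>

lemma total_score_antimono:
  assumes "\<omega> \<in> space M" and "x \<le> y"
  shows "total_score d X b t y \<omega> \<le> total_score d X b t x \<omega>"
  unfolding total_score_eq_sum[OF assms(1)] response_score_def
  by (intro sum_mono item_score_antimono assms)

lemma continuous_on_total_score: "continuous_on S (\<lambda>x. total_score d X b t x \<omega>)"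
  unfolding total_score_def item_score_def by (intro continuous_intros)

text \<open>The first answers alone provide the drift; revisions can only add to it.\<close>

lemma total_score_drift:
  assumes "x < y"
  shows "\<exists>\<delta>>0. \<forall>\<omega>\<in>space M. \<forall>t.
    total_score d X b t y \<omega> \<le> total_score d X b t x \<omega> - \<delta> * real (items_seen d t \<omega>)"
proof -
  have "continuous_on B (\<lambda>\<beta>. mean_slope y \<beta> [] - mean_slope x \<beta> [])"
    by (intro continuous_intros)
  moreover have "0 < mean_slope y \<beta> [] - mean_slope x \<beta> []" if "\<beta> \<in> B" for \<beta>
    using mean_slope_strict_mono[OF assms nondegenerate[OF that]] by simp
  ultimately have "\<exists>\<delta>>0. \<forall>\<beta>\<in>B. \<delta> \<le> mean_slope y \<beta> [] - mean_slope x \<beta> []"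
    by (rule compact_uniform_pos[OF compact_B])
  then obtain \<delta> where \<delta>: "0 < \<delta>"
    "\<And>\<beta>. \<beta> \<in> B \<Longrightarrow> \<delta> \<le> mean_slope y \<beta> [] - mean_slope x \<beta> []"
    by blast
  show ?thesis
  proof (intro exI[of _ \<delta>] conjI ballI allI \<delta>(1))
    fix \<omega> t assume \<omega>: "\<omega> \<in> space M"
    have "total_score d X b t y \<omega> \<le> (\<Sum>i=1..items_seen d t \<omega>. item_score x (b i \<omega>) (X i 1 \<omega>) [] +
        (\<Sum>j = 2..attempts d t i \<omega>. item_score x (b i \<omega>) (X i j \<omega>) (answers X i (j - 1) \<omega>)) - \<delta>)"
      unfolding total_score_def
    proof (rule sum_mono)
      fix i assume "i \<in> {1..items_seen d t \<omega>}"
      then have "\<delta> \<le> mean_slope y (b i \<omega>) [] - mean_slope x (b i \<omega>) []"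
        by (intro \<delta> item_in_B \<omega>) simp
      moreover have "(\<Sum>j = 2..attempts d t i \<omega>. item_score y (b i \<omega>) (X i j \<omega>) (answers X i (j - 1) \<omega>))
          \<le> (\<Sum>j = 2..attempts d t i \<omega>. item_score x (b i \<omega>) (X i j \<omega>) (answers X i (j - 1) \<omega>))"
        using assms by (intro sum_mono item_score_antimono) simp
      ultimately show "item_score y (b i \<omega>) (X i 1 \<omega>) [] +
          (\<Sum>j = 2..attempts d t i \<omega>. item_score y (b i \<omega>) (X i j \<omega>) (answers X i (j - 1) \<omega>))
        \<le> item_score x (b i \<omega>) (X i 1 \<omega>) [] +
          (\<Sum>j = 2..attempts d t i \<omega>. item_score x (b i \<omega>) (X i j \<omega>) (answers X i (j - 1) \<omega>)) - \<delta>"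
        by (simp add: item_score_def)
    qed
    then show "total_score d X b t y \<omega> \<le> total_score d X b t x \<omega> - \<delta> * real (items_seen d t \<omega>)"
      by (simp add: total_score_def sum_subtractf mult.commute)
  qed
qed

text \<open>First responses carry information bounded below over the pool, and revisions contribute
  nonnegative terms.\<close>

lemma total_info_lower_bound:
  "\<exists>c>0. \<forall>\<omega>\<in>space M. \<forall>t. c * real (items_seen d t \<omega>) \<le> total_info d X b t \<theta> \<omega>"
proof -
  have "continuous_on B (\<lambda>\<beta>. item_info \<theta> \<beta> [])"
    by (intro continuous_intros)
  then have "\<exists>c>0. \<forall>\<beta>\<in>B. c \<le> item_info \<theta> \<beta> []"
    by (rule compact_uniform_pos[OF compact_B _ item_info_pos[OF nondegenerate]])
  then obtain c where c: "0 < c" "\<And>\<beta>. \<beta> \<in> B \<Longrightarrow> c \<le> item_info \<theta> \<beta> []"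
    by blast
  show ?thesis
  proof (intro exI[of _ c] conjI ballI allI c(1))
    fix \<omega> t assume \<omega>: "\<omega> \<in> space M"
    have "c * real (items_seen d t \<omega>) = (\<Sum>i=1..items_seen d t \<omega>. c)" by simp
    also have "\<dots> \<le> (\<Sum>i=1..items_seen d t \<omega>. item_info \<theta> (b i \<omega>) [])"
      by (intro sum_mono c item_in_B \<omega>) simp
    also have "\<dots> \<le> total_info d X b t \<theta> \<omega>"
      unfolding total_info_def revision_info_def by (simp add: sum_nonneg item_info_nonneg)
    finally show "c * real (items_seen d t \<omega>) \<le> total_info d X b t \<theta> \<omega>" .
  qed
qed

lemma completion_time_at_top:
  assumes "\<omega> \<in> space M"
  shows "filterlim (\<lambda>n. completion_time d n \<omega>) at_top sequentially"
  by (rule filterlim_at_top_mono[OF filterlim_ident])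
    (auto intro!: eventually_sequentiallyI[of 1] completion_time_bounds(1) assms)

lemma estimator_consistent:
  assumes est: "score_root_estimator M d X b est" and \<omega>: "\<omega> \<in> space M"
    and law: "(\<lambda>t. total_score d X b t \<theta> \<omega> / real t) \<longlonglongrightarrow> 0"
  shows "(\<lambda>n. est (completion_time d n \<omega>) \<omega>) \<longlonglongrightarrow> \<theta>"
proof (rule tendstoI)
  fix e :: real assume e: "0 < e"
  let ?T = "\<lambda>n. completion_time d n \<omega>" and ?S = "\<lambda>t x. total_score d X b t x \<omega>"
  obtain \<delta>1 where \<delta>1: "0 < \<delta>1" "\<And>t. ?S t (\<theta> + e) \<le> ?S t \<theta> - \<delta>1 * real (items_seen d t \<omega>)"
    using total_score_drift[of \<theta> "\<theta> + e"] e \<omega> by (metis less_add_same_cancel1)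
  obtain \<delta>2 where \<delta>2: "0 < \<delta>2" "\<And>t. ?S t \<theta> \<le> ?S t (\<theta> - e) - \<delta>2 * real (items_seen d t \<omega>)"
    using total_score_drift[of "\<theta> - e" \<theta>] e \<omega> by (metis diff_less_eq less_add_same_cancel1)
  \<comment> \<open>Dividing by \<open>m\<close> turns a bound per response into one per item, as at
    most \<open>n * (m - 1)\<close> responses precede the completion of \<open>n\<close>
    items.\<close>
  define \<delta> where "\<delta> = min \<delta>1 \<delta>2 / real m"
  have "0 < \<delta>" using \<delta>1 \<delta>2 m_ge by (simp add: \<delta>_def)
  with tendstoD[OF filterlim_compose[OF law completion_time_at_top[OF \<omega>]]]
  have "\<forall>\<^sub>F n in sequentially. dist (?S (?T n) \<theta> / real (?T n)) 0 < \<delta>" by simp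
  then show "\<forall>\<^sub>F n in sequentially. dist (est (?T n) \<omega>) \<theta> < e"
    using eventually_ge_at_top[of 1]
  proof eventually_elim
    case (elim n)
    note T = completion_time[OF \<omega> elim(2)]
    have "\<bar>?S (?T n) \<theta>\<bar> < \<delta> * real (?T n)"
      using elim(1) T(1) by (simp add: pos_divide_less_eq)
    also have "\<dots> \<le> \<delta> * real (n * m)"
      using completion_time_bounds(2)[OF \<omega> elim(2)] \<open>0 < \<delta>\<close>
      by (intro mult_left_mono of_nat_mono) (auto intro: order_trans)
    also have "\<dots> = min \<delta>1 \<delta>2 * real n"
      using m_ge by (simp add: \<delta>_def)
    finally have small: "\<bar>?S (?T n) \<theta>\<bar> < min \<delta>1 \<delta>2 * real n" .
    have "min \<delta>1 \<delta>2 * real n \<le> \<delta>1 * real n" "min \<delta>1 \<delta>2 * real n \<le> \<delta>2 * real n"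
      by (auto intro: mult_right_mono)
    with small have neg: "?S (?T n) (\<theta> + e) < 0" and pos: "0 < ?S (?T n) (\<theta> - e)"
      using \<delta>1(2)[of "?T n"] \<delta>2(2)[of "?T n"] unfolding T(2) by linarith+
    \<comment> \<open>The sign change yields a root, so the estimator is now a root of the score and
      not an initial value.\<close>
    have "\<exists>x. \<theta> - e \<le> x \<and> x \<le> \<theta> + e \<and> ?S (?T n) x = 0"
      using neg pos e by (intro IVT2' continuous_on_total_score) auto
    then have root: "?S (?T n) (est (?T n) \<omega>) = 0"
      using est \<omega> T(1) unfolding score_root_estimator_def by blast
    \<comment> \<open>At or beyond \<open>\<theta> + e\<close> the nonincreasing score is negative,
      so no root lies there.\<close>
    have "est (?T n) \<omega> < \<theta> + e"
      using total_score_antimono[OF \<omega>, of "\<theta> + e" "est (?T n) \<omega>" "?T n"] root neg by linarith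
    moreover have "\<theta> - e < est (?T n) \<omega>"
      using total_score_antimono[OF \<omega>, of "est (?T n) \<omega>" "\<theta> - e" "?T n"] root pos by linarith
    ultimately show ?case by (simp add: dist_real_def abs_less_iff)
  qed
qed

text \<open>The information changes by little per response and grows at least linearly in the number
  of items, while responses per item are bounded.\<close>

lemma total_info_ratio:
  assumes \<omega>: "\<omega> \<in> space M" and lim: "(\<lambda>n. x (completion_time d n \<omega>)) \<longlonglongrightarrow> \<theta>"
  shows "(\<lambda>n. total_info d X b (completion_time d n \<omega>) (x (completion_time d n \<omega>)) \<omega>
    / total_info d X b (completion_time d n \<omega>) \<theta> \<omega>) \<longlonglongrightarrow> 1"
proof (rule tendstoI)
  fix e :: real assume e: "0 < e"
  let ?T = "\<lambda>n. completion_time d n \<omega>" and ?I = "\<lambda>t x. total_info d X b t x \<omega>"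
  obtain c where c: "0 < c" "\<And>t. c * real (items_seen d t \<omega>) \<le> ?I t \<theta>"
    using total_info_lower_bound \<omega> by blast
  \<comment> \<open>Chosen so that \<open>n * m\<close> errors of size \<open>\<eta>\<close> total
    \<open>e * (c * n)\<close>, at most \<open>e\<close> times the information at
    \<open>\<theta>\<close>.\<close>
  define \<eta> where "\<eta> = e * c / real m"
  have "0 < \<eta>" using e c m_ge by (simp add: \<eta>_def)
  have "\<forall>\<^sub>F n in sequentially. \<forall>\<beta>\<in>B. \<forall>xs. \<bar>item_info (x (?T n)) \<beta> xs - item_info \<theta> \<beta> xs\<bar> < \<eta>"
    using lim item_info_equicontinuous[OF compact_B \<open>0 < \<eta>\<close>] by (rule eventually_compose_filterlim[rotated])
  then show "\<forall>\<^sub>F n in sequentially. dist (?I (?T n) (x (?T n)) / ?I (?T n) \<theta>) 1 < e"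
    using eventually_ge_at_top[of 1]
  proof eventually_elim
    case (elim n)
    note T = completion_time[OF \<omega> elim(2)]
    have I: "c * real n \<le> ?I (?T n) \<theta>"
      using c(2)[of "?T n"] unfolding T(2) .
    with c elim(2) have I_pos: "0 < ?I (?T n) \<theta>"
      by (meson less_le_trans mult_pos_pos of_nat_0_less_iff zero_less_one)
    have "\<bar>?I (?T n) (x (?T n)) - ?I (?T n) \<theta>\<bar> \<le> (\<Sum>s<?T n. \<eta>)"
      unfolding total_info_eq_sum[OF \<omega>] sum_subtractf[symmetric]
      using elim(1) current_item_in_B[OF \<omega>]
      by (intro order_trans[OF sum_abs] sum_mono) (auto intro: less_imp_le)
    also have "\<dots> = real (?T n) * \<eta>" by simp
    also have "\<dots> < real (n * m) * \<eta>"
    proof (intro mult_strict_right_mono \<open>0 < \<eta>\<close>)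
      have "n * (m - 1) < n * m" using elim(2) m_ge by simp
      with completion_time_bounds(2)[OF \<omega> elim(2)] show "real (?T n) < real (n * m)"
        by (simp only: of_nat_less_iff)
    qed
    also have "\<dots> = e * (c * real n)"
      using m_ge by (simp add: \<eta>_def)
    also have "\<dots> \<le> e * ?I (?T n) \<theta>"
      using I e by simp
    finally have "\<bar>?I (?T n) (x (?T n)) - ?I (?T n) \<theta>\<bar> < e * ?I (?T n) \<theta>" .
    then have "\<bar>?I (?T n) (x (?T n)) - ?I (?T n) \<theta>\<bar> / ?I (?T n) \<theta> < e"
      using I_pos by (simp add: pos_divide_less_eq)
    moreover have "?I (?T n) (x (?T n)) / ?I (?T n) \<theta> - 1 =
        (?I (?T n) (x (?T n)) - ?I (?T n) \<theta>) / ?I (?T n) \<theta>"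
      using I_pos by (simp add: diff_divide_distrib)
    ultimately show ?case
      using I_pos by (simp add: dist_real_def)
  qed
qed

end

theorem theorem4p1:
  fixes m :: nat
    and \<theta> :: real
    and M :: "'w measure"
    and B :: "'k::finite item set"
    and d :: "nat \<Rightarrow> 'w \<Rightarrow> nat"
    and X :: "nat \<Rightarrow> nat \<Rightarrow> 'w \<Rightarrow> 'k option"
    and b :: "nat \<Rightarrow> 'w \<Rightarrow> 'k item"
    and est :: "nat \<Rightarrow> 'w \<Rightarrow> real"
  assumes "m = CARD('k option)" and "m \<ge> 3"
    and "B \<noteq> {}" and "compact B" and "\<And>\<beta>. \<beta> \<in> B \<Longrightarrow> nondegenerate_item \<beta>"
    and "prob_space M"
    and "revision_strategy m M d"
    and "item_selection_strategy M d X B b"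
    and "nominal_responses M \<theta> d X b"
    and "score_root_estimator M d X b est"
  shows "AE \<omega> in M.
    (\<lambda>n. est (completion_time d n \<omega>) \<omega>) \<longlonglongrightarrow> \<theta> \<and>
    (\<lambda>n. total_info d X b (completion_time d n \<omega>) (est (completion_time d n \<omega>) \<omega>) \<omega>
          / total_info d X b (completion_time d n \<omega>) \<theta> \<omega>) \<longlonglongrightarrow> 1"
proof -
  interpret prob_space M by fact
  interpret revision_test m M d X \<theta> B b
    using assms by unfold_locales (auto simp: nominal_responses_def)
  \<comment> \<open>The strong law supplies the exceptional null set; everything after it is an
    argument along a single path.\<close>
  from score_strong_law AE_space show ?thesis
  proof eventually_elim
    case (elim \<omega>)
    have "(\<lambda>n. est (completion_time d n \<omega>) \<omega>) \<longlonglongrightarrow> \<theta>"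
      using estimator_consistent[OF assms(10) elim(2,1)] .
    with total_info_ratio[OF elim(2), of "\<lambda>t. est t \<omega>"] show ?case by blast
  qed
qed

end
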